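(* Let $(p:\mathcal G\to M,\omega)$ be a parabolic geometry of type $(G,P)$, let $\mathbb V$ be a finite-dimensional irreducible representation of $G$ with natural grading $\mathbb V=\mathbb V_0\oplus\dots\oplus\mathbb V_N$, and suppose that $\alpha\in\Gamma(\mathcal H_0M)$ is a normal solution to the first BGG operator determined by $\mathbb V$. Then for any point $u_0\in\mathcal G$, with associated normal section $\sigma:U\to\mathcal G$, the coefficients of $\alpha|_U$ in a normal frame of $\mathcal H_0M$ determined by $u_0$ are polynomials of degree at most $N$ in the normal coordinates determined by $u_0$.
   Context: Let $\mathfrak g$ be a real or complex semisimple Lie algebra with a $|k|$-grading $\mathfrak g=\mathfrak g_{-k}\oplus\dots\oplus\mathfrak g_k$ ($k\ge1$): $[\mathfrak g_i,\mathfrak g_j]\subset\mathfrak g_{i+j}$, no simple ideal of $\mathfrak g$ is contained in $\mathfrak g_0$, and $\mathfrak g_-:=\mathfrak g_{-k}\oplus\dots\oplus\mathfrak g_{-1}$ is generated by $\mathfrak g_{-1}$. Put $\mathfrak p=\mathfrak g_0\oplus\dots\oplus\mathfrak g_k$. Let $G$ be a Lie group with Lie algebra $\mathfrak g$ and $P\subset G$ a subgroup lying between the normaliser $N_G(\mathfrak p)$ and its identity component. A parabolic geometry of type $(G,P)$ on a smooth manifold $M$ is a principal $P$-bundle $p:\mathcal G\to M$ with a Cartan connection $\omega\in\Omega^1(\mathcal G,\mathfrak g)$: each $\omega_u:T_u\mathcal G\to\mathfrak g$ is a linear isomorphism, $\omega$ is $P$-equivariant, and $\omega$ reproduces the generators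 of fundamental vector fields. Normal data: Fix $u_0\in\mathcal G$, $x_0=p(u_0)$. For $X\in\mathfrak g_-$ let $\tilde X$ be the vector field on $\mathcal G$ with $\omega(\tilde X)=X$. For $X$ in a sufficiently small open neighbourhood $V$ of $0$ in $\mathfrak g_-$ put $\Phi(X)=\mathrm{Fl}^{\tilde X}_1(u_0)$ (flow at time $1$) and $\varphi=p\circ\Phi$, where $V$ is chosen so that $\varphi$ is a diffeomorphism onto an open neighbourhood $U$ of $x_0$. Then $\varphi^{-1}:U\to V\subset\mathfrak g_-$ is the normal chart; a choice of basis of $\mathfrak g_-$ gives normal coordinates on $U$; the normal section $\sigma:U\to\mathcal G$ is defined by $\sigma(\varphi(X))=\Phi(X)$. For a representation $\mathbb W$ of $P$, with associated bundle $\mathcal WM=\mathcal G\times_P\mathbb W$, a normal frame determined by $u_0$ is a frame over $U$ of the form $x\mapsto[(\sigma(x),w_i)]$ for a basis $\{w_i\}$ of $\mathbb W$. Representations: For a finite-dimensional irreducible representation $\mathbb V$ of $G$, the eigenspaces of the grading element $E\in\mathfrak g$ (characterised by $[E,X]=iX$ for $X\in\mathfrak g_i$) give, after shifting degrees, the natural grading $\mathbb V=\mathbb V_0\oplus\dots\oplus\mathbb V_N$ with $\mathfrak g_i\cdot\mathbb V_j\subset\mathbb V_{i+j}$. Put $\mathbb V^i=\mathbb V_i\oplus\dots\oplus\mathbb V_N$ (these are $P$-invariant) and $\mathbb H_0=\mathbb V/\mathbb V^1$. Let $\mathcal VM=\mathcal G\times_P\mathbb V$ (tractor bundle), $\mathcal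 H_0M=\mathcal G\times_P\mathbb H_0$, and let $\Pi:\mathcal VM\to\mathcal H_0M$ be the natural projection. The tractor connection $\nabla$ on $\mathcal VM$ is defined as follows: if $s\in\Gamma(\mathcal VM)$ corresponds to the $P$-equivariant function $\tilde f:\mathcal G\to\mathbb V$, then $\nabla_\xi s$ at $p(u)$, for $\xi=T_up\cdot\omega_u^{-1}(X)$, $X\in\mathfrak g$, is represented by $(u,\ (\omega_u^{-1}(X)\cdot\tilde f)(u)+X\cdot\tilde f(u))$. A normal solution of the first BGG operator determined by $\mathbb V$ is a section $\alpha\in\Gamma(\mathcal H_0M)$ of the form $\alpha=\Pi(s)$ for a section $s\in\Gamma(\mathcal VM)$ parallel for $\nabla$ (such $\alpha$ automatically lies in the kernel of the first BGG operator). *)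

theory Defs
  imports "HOL-Analysis.Analysis" "HOL-Algebra.Group"
begin

text \<open>
  Scalars range over a type of class \<open>real_normed_field\<close>. By the Gelfand-Mazur theorem the only
  such fields are the real and the complex numbers, so statements that are polymorphic in
  the scalars cover exactly the real and the complex case.
  Finite-dimensional vector spaces are types of class \<open>euclidean_space\<close> together with a scalar
  multiplication that extends the given real one; the inner product of the type only serves to
  provide the standard topology and a real basis.
\<close>

definition scalar_mult :: "('k::real_normed_field \<Rightarrow> 'v::euclidean_space \<Rightarrow> 'v) \<Rightarrow> bool" where
  "scalar_mult s \<longleftrightarrow> vector_space s \<and> (\<forall>r v. s (of_real r) v = r *\<^sub>R v)"

definition direct_sum :: "'i set \<Rightarrow> ('i \<Rightarrow> 'v::comm_monoid_add set) \<Rightarrow> bool" where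
  "direct_sum I W \<longleftrightarrow>
     (\<forall>v. \<exists>!x. (\<forall>i\<in>I. x i \<in> W i) \<and> (\<forall>i. i \<notin> I \<longrightarrow> x i = 0) \<and> v = (\<Sum>i\<in>I. x i))"

definition graded_part :: "('i \<Rightarrow> 'v::comm_monoid_add set) \<Rightarrow> 'i set \<Rightarrow> 'v set" where
  "graded_part W I = {\<Sum>i\<in>I. x i | x. \<forall>i\<in>I. x i \<in> W i}"


section \<open>Graded semisimple Lie algebras\<close>

definition lie_algebra ::
  "('k::real_normed_field \<Rightarrow> 'g::euclidean_space \<Rightarrow> 'g) \<Rightarrow> ('g \<Rightarrow> 'g \<Rightarrow> 'g) \<Rightarrow> bool" where
  "lie_algebra sg br \<longleftrightarrow> scalar_mult sg
     \<and> (\<forall>X. Vector_Spaces.linear sg sg (br X))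
     \<and> (\<forall>Y. Vector_Spaces.linear sg sg (\<lambda>X. br X Y))
     \<and> (\<forall>X. br X X = 0)
     \<and> (\<forall>X Y Z. br X (br Y Z) + br Y (br Z X) + br Z (br X Y) = 0)"

definition lie_subalgebra ::
  "('k::real_normed_field \<Rightarrow> 'g::euclidean_space \<Rightarrow> 'g) \<Rightarrow> ('g \<Rightarrow> 'g \<Rightarrow> 'g) \<Rightarrow> 'g set \<Rightarrow> bool" where
  "lie_subalgebra sg br S \<longleftrightarrow> module.subspace sg S \<and> (\<forall>X\<in>S. \<forall>Y\<in>S. br X Y \<in> S)"

definition lie_generated ::
  "('k::real_normed_field \<Rightarrow> 'g::euclidean_space \<Rightarrow> 'g) \<Rightarrow> ('g \<Rightarrow> 'g \<Rightarrow> 'g) \<Rightarrow> 'g set \<Rightarrow> 'g set" where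
  "lie_generated sg br S = \<Inter>{T. lie_subalgebra sg br T \<and> S \<subseteq> T}"

definition lie_ideal ::
  "('k::real_normed_field \<Rightarrow> 'g::euclidean_space \<Rightarrow> 'g) \<Rightarrow> ('g \<Rightarrow> 'g \<Rightarrow> 'g) \<Rightarrow> 'g set \<Rightarrow> 'g set \<Rightarrow> bool" where
  "lie_ideal sg br S I \<longleftrightarrow> module.subspace sg I \<and> I \<subseteq> S \<and> (\<forall>X\<in>S. \<forall>Y\<in>I. br X Y \<in> I)"

primrec derived_series ::
  "('k::real_normed_field \<Rightarrow> 'g::euclidean_space \<Rightarrow> 'g) \<Rightarrow> ('g \<Rightarrow> 'g \<Rightarrow> 'g) \<Rightarrow> 'g set \<Rightarrow> nat \<Rightarrow> 'g set" where
  "derived_series sg br S 0 = S"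
| "derived_series sg br S (Suc n) =
     module.span sg {br X Y | X Y. X \<in> derived_series sg br S n \<and> Y \<in> derived_series sg br S n}"

definition semisimple_lie_algebra ::
  "('k::real_normed_field \<Rightarrow> 'g::euclidean_space \<Rightarrow> 'g) \<Rightarrow> ('g \<Rightarrow> 'g \<Rightarrow> 'g) \<Rightarrow> bool" where
  "semisimple_lie_algebra sg br \<longleftrightarrow> lie_algebra sg br
     \<and> (\<forall>I. lie_ideal sg br UNIV I \<and> (\<exists>n. derived_series sg br I n = {0}) \<longrightarrow> I = {0})"

definition simple_ideal ::
  "('k::real_normed_field \<Rightarrow> 'g::euclidean_space \<Rightarrow> 'g) \<Rightarrow> ('g \<Rightarrow> 'g \<Rightarrow> 'g) \<Rightarrow> 'g set \<Rightarrow> bool" where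
  "simple_ideal sg br I \<longleftrightarrow> lie_ideal sg br UNIV I
     \<and> (\<exists>X\<in>I. \<exists>Y\<in>I. br X Y \<noteq> 0)
     \<and> (\<forall>J. lie_ideal sg br I J \<longrightarrow> J = {0} \<or> J = I)"

definition g_minus :: "nat \<Rightarrow> (int \<Rightarrow> 'g::euclidean_space set) \<Rightarrow> 'g set" where
  "g_minus k gr = graded_part gr {- int k..-1}"

definition parabolic_subalgebra :: "nat \<Rightarrow> (int \<Rightarrow> 'g::euclidean_space set) \<Rightarrow> 'g set" where
  "parabolic_subalgebra k gr = graded_part gr {0..int k}"

definition k_grading ::
  "('k::real_normed_field \<Rightarrow> 'g::euclidean_space \<Rightarrow> 'g) \<Rightarrow> ('g \<Rightarrow> 'g \<Rightarrow> 'g) \<Rightarrow> nat \<Rightarrow> (int \<Rightarrow> 'g set) \<Rightarrow> bool"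
where
  "k_grading sg br k gr \<longleftrightarrow> k \<ge> 1
     \<and> (\<forall>i. module.subspace sg (gr i))
     \<and> (\<forall>i. \<bar>i\<bar> > int k \<longrightarrow> gr i = {0})
     \<and> direct_sum {- int k..int k} gr
     \<and> (\<forall>i j. \<forall>X\<in>gr i. \<forall>Y\<in>gr j. br X Y \<in> gr (i + j))
     \<and> (\<nexists>I. simple_ideal sg br I \<and> I \<subseteq> gr 0)
     \<and> lie_generated sg br (gr (-1)) = g_minus k gr"

definition grading_element ::
  "('g::euclidean_space \<Rightarrow> 'g \<Rightarrow> 'g) \<Rightarrow> (int \<Rightarrow> 'g set) \<Rightarrow> 'g \<Rightarrow> bool" where
  "grading_element br gr E \<longleftrightarrow> (\<forall>i. \<forall>X\<in>gr i. br E X = of_int i *\<^sub>R X)"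


section \<open>Smooth manifolds\<close>

primrec Ck_on :: "nat \<Rightarrow> 'a::real_normed_vector set \<Rightarrow> ('a \<Rightarrow> 'b::real_normed_vector) \<Rightarrow> bool" where
  "Ck_on 0 S f = continuous_on S f"
| "Ck_on (Suc n) S f = ((\<forall>x\<in>S. f differentiable (at x))
     \<and> (\<forall>v. Ck_on n S (\<lambda>x. frechet_derivative f (at x) v)))"

definition C_infty_on :: "'a::real_normed_vector set \<Rightarrow> ('a \<Rightarrow> 'b::real_normed_vector) \<Rightarrow> bool" where
  "C_infty_on S f \<longleftrightarrow> open S \<and> (\<forall>n. Ck_on n S f)"

type_synonym ('m, 'e) chart = "'m set \<times> ('m \<Rightarrow> 'e)"

text \<open>
  A manifold is a whole type (Hausdorff and second countable, as imposed by its type class where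
  manifolds are introduced below) with an atlas, not necessarily maximal.
\<close>

definition smooth_atlas :: "('m::topological_space, 'e::euclidean_space) chart set \<Rightarrow> bool" where
  "smooth_atlas A \<longleftrightarrow> (\<Union>(U, \<phi>)\<in>A. U) = UNIV
     \<and> (\<forall>(U, \<phi>)\<in>A. open U \<and> open (\<phi> ` U) \<and> (\<exists>\<psi>. homeomorphism U (\<phi> ` U) \<phi> \<psi>))
     \<and> (\<forall>(U, \<phi>)\<in>A. \<forall>(U', \<phi>')\<in>A. C_infty_on (\<phi> ` (U \<inter> U')) (\<phi>' \<circ> inv_into U \<phi>))"

definition std_atlas :: "('e::euclidean_space, 'e) chart set" where
  "std_atlas = {(UNIV, id)}"

definition prod_atlas ::
  "('m, 'e) chart set \<Rightarrow> ('n, 'f) chart set \<Rightarrow> ('m \<times> 'n, 'e \<times> 'f) chart set" where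
  "prod_atlas A B = {(U \<times> W, map_prod \<phi> \<psi>) | U \<phi> W \<psi>. (U, \<phi>) \<in> A \<and> (W, \<psi>) \<in> B}"

definition smooth_open_on ::
  "('m::topological_space, 'e::euclidean_space) chart set \<Rightarrow>
   ('n::topological_space, 'f::euclidean_space) chart set \<Rightarrow> 'm set \<Rightarrow> ('m \<Rightarrow> 'n) \<Rightarrow> bool" where
  "smooth_open_on A B S f \<longleftrightarrow> open S \<and> continuous_on S f
     \<and> (\<forall>(U, \<phi>)\<in>A. \<forall>(W, \<psi>)\<in>B.
          C_infty_on (\<phi> ` {x \<in> S \<inter> U. f x \<in> W}) (\<psi> \<circ> f \<circ> inv_into U \<phi>))"

text \<open>
  Smoothness on an arbitrary subset means local extendability to a smooth map on an open set.
  On an embedded submanifold (such as a closed subgroup of a Lie group, or an open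
  subset of a linear subspace) this is smoothness for the submanifold structure.
\<close>

definition smooth_on ::
  "('m::topological_space, 'e::euclidean_space) chart set \<Rightarrow>
   ('n::topological_space, 'f::euclidean_space) chart set \<Rightarrow> 'm set \<Rightarrow> ('m \<Rightarrow> 'n) \<Rightarrow> bool" where
  "smooth_on A B S f \<longleftrightarrow>
     (\<forall>x\<in>S. \<exists>O' F. x \<in> O' \<and> smooth_open_on A B O' F \<and> (\<forall>y\<in>O' \<inter> S. F y = f y))"

definition smooth_fun ::
  "('m::topological_space, 'e::euclidean_space) chart set \<Rightarrow> ('m \<Rightarrow> 'v::euclidean_space) \<Rightarrow> bool" where
  "smooth_fun A f \<longleftrightarrow> smooth_on A std_atlas UNIV f"


section \<open>Tangent vectors, vector fields and flows\<close>

text \<open>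
  Tangent vectors at \<open>x\<close> are the derivations at \<open>x\<close> of the algebra of smooth real functions. They
  are extended by zero to the non-smooth functions, to have extensional equality.
\<close>

type_synonym 'm tvec = "('m \<Rightarrow> real) \<Rightarrow> real"

definition tangent_space ::
  "('m::topological_space, 'e::euclidean_space) chart set \<Rightarrow> 'm \<Rightarrow> 'm tvec set" where
  "tangent_space A x = {D.
     (\<forall>h. \<not> smooth_fun A h \<longrightarrow> D h = 0)
     \<and> (\<forall>h h'. smooth_fun A h \<and> smooth_fun A h' \<longrightarrow> D (\<lambda>y. h y + h' y) = D h + D h')
     \<and> (\<forall>r h. smooth_fun A h \<longrightarrow> D (\<lambda>y. r * h y) = r * D h)
     \<and> (\<forall>h h'. smooth_fun A h \<and> smooth_fun A h' \<longrightarrow>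
          D (\<lambda>y. h y * h' y) = h x * D h' + h' x * D h)}"

definition pushforward ::
  "('n::topological_space, 'f::euclidean_space) chart set \<Rightarrow> ('m \<Rightarrow> 'n) \<Rightarrow> 'm tvec \<Rightarrow> 'n tvec" where
  "pushforward B f D = (\<lambda>h. if smooth_fun B h then D (h \<circ> f) else 0)"

definition velocity ::
  "('m::topological_space, 'e::euclidean_space) chart set \<Rightarrow> (real \<Rightarrow> 'm) \<Rightarrow> real \<Rightarrow> 'm tvec" where
  "velocity A c t = (\<lambda>h. if smooth_fun A h then deriv (h \<circ> c) t else 0)"

text \<open>The derivative \<open>D \<cdot> f\<close> of a vector-valued function, taken componentwise.\<close>

definition dir_deriv :: "'m tvec \<Rightarrow> ('m \<Rightarrow> 'v::euclidean_space) \<Rightarrow> 'v" where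
  "dir_deriv D f = (\<Sum>b\<in>Basis. D (\<lambda>x. f x \<bullet> b) *\<^sub>R b)"

definition smooth_vector_field ::
  "('m::topological_space, 'e::euclidean_space) chart set \<Rightarrow> ('m \<Rightarrow> 'm tvec) \<Rightarrow> bool" where
  "smooth_vector_field A \<xi> \<longleftrightarrow> (\<forall>x. \<xi> x \<in> tangent_space A x)
     \<and> (\<forall>h. smooth_fun A h \<longrightarrow> smooth_fun A (\<lambda>x. \<xi> x h))"

text \<open>
  The curve \<open>c\<close> is required to satisfy \<open>c' = \<xi> \<circ> c\<close> when tested on all smooth functions; for smooth
  \<open>\<xi>\<close> on a Hausdorff manifold this makes \<open>c\<close> itself continuous and smooth.
\<close>

definition integral_curve ::
  "('m::topological_space, 'e::euclidean_space) chart set \<Rightarrow> ('m \<Rightarrow> 'm tvec) \<Rightarrow> real set \<Rightarrow>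
   (real \<Rightarrow> 'm) \<Rightarrow> bool" where
  "integral_curve A \<xi> J c \<longleftrightarrow> open J \<and> connected J
     \<and> (\<forall>t\<in>J. \<forall>h. smooth_fun A h \<longrightarrow> ((h \<circ> c) has_real_derivative \<xi> (c t) h) (at t))"

definition flows_to ::
  "('m::topological_space, 'e::euclidean_space) chart set \<Rightarrow> ('m \<Rightarrow> 'm tvec) \<Rightarrow> real \<Rightarrow> 'm \<Rightarrow> 'm \<Rightarrow> bool"
where
  "flows_to A \<xi> t x y \<longleftrightarrow> (\<exists>J c. 0 \<in> J \<and> t \<in> J \<and> integral_curve A \<xi> J c \<and> c 0 = x \<and> c t = y)"

text \<open>
  The endpoint is unique by uniqueness of integral curves, so the choice is no choice; the value is
  only meaningful if the flow is defined up to time \<open>t\<close>.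
\<close>

definition flow ::
  "('m::topological_space, 'e::euclidean_space) chart set \<Rightarrow> ('m \<Rightarrow> 'm tvec) \<Rightarrow> real \<Rightarrow> 'm \<Rightarrow> 'm" where
  "flow A \<xi> t x = (SOME y. flows_to A \<xi> t x y)"


section \<open>Lie groups\<close>

definition lie_group ::
  "('a::{t2_space,second_countable_topology}, 'z) monoid_scheme \<Rightarrow> ('a, 'e::euclidean_space) chart set \<Rightarrow> bool"
where
  "lie_group G AG \<longleftrightarrow> Group.group G \<and> carrier G = UNIV \<and> smooth_atlas AG
     \<and> smooth_on (prod_atlas AG AG) AG UNIV (\<lambda>(a, b). a \<otimes>\<^bsub>G\<^esub> b)
     \<and> smooth_on AG AG UNIV (\<lambda>a. inv\<^bsub>G\<^esub> a)"

text \<open>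
  \<open>L\<close> identifies the Lie algebra with bracket \<open>br\<close> with the left invariant vector fields on \<open>G\<close>
  (under the commutator of vector fields), and by evaluation at the unit with the tangent space
  there. If the Lie algebra is complex, it is the underlying real Lie algebra that matters here.
\<close>

definition lie_algebra_of ::
  "('a::{t2_space,second_countable_topology}, 'z) monoid_scheme \<Rightarrow> ('a, 'e::euclidean_space) chart set \<Rightarrow>
   ('g::euclidean_space \<Rightarrow> 'g \<Rightarrow> 'g) \<Rightarrow> ('g \<Rightarrow> 'a \<Rightarrow> 'a tvec) \<Rightarrow> bool" where
  "lie_algebra_of G AG br L \<longleftrightarrow>
     (\<forall>X. smooth_vector_field AG (L X))
     \<and> (\<forall>X Y a h. L (X + Y) a h = L X a h + L Y a h)
     \<and> (\<forall>r X a h. L (r *\<^sub>R X) a h = r * L X a h)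
     \<and> (\<forall>X a b. pushforward AG (\<lambda>y. a \<otimes>\<^bsub>G\<^esub> y) (L X b) = L X (a \<otimes>\<^bsub>G\<^esub> b))
     \<and> bij_betw (\<lambda>X. L X \<one>\<^bsub>G\<^esub>) UNIV (tangent_space AG \<one>\<^bsub>G\<^esub>)
     \<and> (\<forall>X Y a h. smooth_fun AG h \<longrightarrow>
          L (br X Y) a h = L X a (\<lambda>b. L Y b h) - L Y a (\<lambda>b. L X b h))"

definition lie_exp ::
  "('a::{t2_space,second_countable_topology}, 'z) monoid_scheme \<Rightarrow> ('a, 'e::euclidean_space) chart set \<Rightarrow>
   ('g::euclidean_space \<Rightarrow> 'a \<Rightarrow> 'a tvec) \<Rightarrow> 'g \<Rightarrow> 'a" where
  "lie_exp G AG L X = flow AG (L X) 1 \<one>\<^bsub>G\<^esub>"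

definition Ad ::
  "('a::{t2_space,second_countable_topology}, 'z) monoid_scheme \<Rightarrow> ('a, 'e::euclidean_space) chart set \<Rightarrow>
   ('g::euclidean_space \<Rightarrow> 'a \<Rightarrow> 'a tvec) \<Rightarrow> 'a \<Rightarrow> 'g \<Rightarrow> 'g" where
  "Ad G AG L a X = (THE Y. L Y \<one>\<^bsub>G\<^esub> =
     pushforward AG (\<lambda>b. a \<otimes>\<^bsub>G\<^esub> b \<otimes>\<^bsub>G\<^esub> inv\<^bsub>G\<^esub> a) (L X \<one>\<^bsub>G\<^esub>))"

definition normaliser ::
  "('a::{t2_space,second_countable_topology}, 'z) monoid_scheme \<Rightarrow> ('a, 'e::euclidean_space) chart set \<Rightarrow>
   ('g::euclidean_space \<Rightarrow> 'a \<Rightarrow> 'a tvec) \<Rightarrow> 'g set \<Rightarrow> 'a set" where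
  "normaliser G AG L S = {a \<in> carrier G. Ad G AG L a ` S = S}"

text \<open>
  A subgroup between the normaliser and its identity component is automatically closed, hence
  an embedded Lie subgroup.
\<close>

definition parabolic_type ::
  "('k::real_normed_field \<Rightarrow> 'g::euclidean_space \<Rightarrow> 'g) \<Rightarrow> ('g \<Rightarrow> 'g \<Rightarrow> 'g) \<Rightarrow> nat \<Rightarrow> (int \<Rightarrow> 'g set) \<Rightarrow>
   ('a::{t2_space,second_countable_topology}, 'z) monoid_scheme \<Rightarrow> ('a, 'e::euclidean_space) chart set \<Rightarrow>
   ('g \<Rightarrow> 'a \<Rightarrow> 'a tvec) \<Rightarrow> 'a set \<Rightarrow> bool" where
  "parabolic_type sg br k gr G AG L P \<longleftrightarrow>
     semisimple_lie_algebra sg br \<and> k_grading sg br k gr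
     \<and> lie_group G AG \<and> lie_algebra_of G AG br L \<and> subgroup P G
     \<and> connected_component_set (normaliser G AG L (parabolic_subalgebra k gr)) \<one>\<^bsub>G\<^esub> \<subseteq> P
     \<and> P \<subseteq> normaliser G AG L (parabolic_subalgebra k gr)"


section \<open>Representations\<close>

definition representation_of ::
  "('a::{t2_space,second_countable_topology}, 'z) monoid_scheme \<Rightarrow> ('a, 'e::euclidean_space) chart set \<Rightarrow>
   ('l::real_normed_field \<Rightarrow> 'v::euclidean_space \<Rightarrow> 'v) \<Rightarrow> ('a \<Rightarrow> 'v \<Rightarrow> 'v) \<Rightarrow> bool" where
  "representation_of G AG sv \<rho> \<longleftrightarrow> scalar_mult sv
     \<and> (\<forall>a. Vector_Spaces.linear sv sv (\<rho> a))
     \<and> (\<forall>v. \<rho> \<one>\<^bsub>G\<^esub> v = v) \<and> (\<forall>a b v. \<rho> (a \<otimes>\<^bsub>G\<^esub> b) v = \<rho> a (\<rho> b v))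
     \<and> (\<forall>v. smooth_fun AG (\<lambda>a. \<rho> a v))"

definition irreducible_rep ::
  "('a::{t2_space,second_countable_topology}, 'z) monoid_scheme \<Rightarrow> ('a, 'e::euclidean_space) chart set \<Rightarrow>
   ('l::real_normed_field \<Rightarrow> 'v::euclidean_space \<Rightarrow> 'v) \<Rightarrow> ('a \<Rightarrow> 'v \<Rightarrow> 'v) \<Rightarrow> bool" where
  "irreducible_rep G AG sv \<rho> \<longleftrightarrow> representation_of G AG sv \<rho>
     \<and> (\<forall>S. module.subspace sv S \<and> (\<forall>a. \<forall>v\<in>S. \<rho> a v \<in> S) \<longrightarrow> S = {0} \<or> S = UNIV)"

text \<open>The action \<open>X \<cdot> v\<close> of the Lie algebra: the derivative of \<open>a \<mapsto> \<rho> a v\<close> at the unit.\<close>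

definition inf_action ::
  "('a::{t2_space,second_countable_topology}, 'z) monoid_scheme \<Rightarrow>
   ('g::euclidean_space \<Rightarrow> 'a \<Rightarrow> 'a tvec) \<Rightarrow> ('a \<Rightarrow> 'v::euclidean_space \<Rightarrow> 'v) \<Rightarrow> 'g \<Rightarrow> 'v \<Rightarrow> 'v" where
  "inf_action G L \<rho> X v = dir_deriv (L X \<one>\<^bsub>G\<^esub>) (\<lambda>a. \<rho> a v)"

text \<open>
  \<open>T\<close> is the action of the grading element; degrees are its eigenvalues shifted by a constant
  so that the lowest one becomes \<open>0\<close>.
\<close>

definition natural_grading ::
  "('l::real_normed_field \<Rightarrow> 'v::euclidean_space \<Rightarrow> 'v) \<Rightarrow> ('v \<Rightarrow> 'v) \<Rightarrow> nat \<Rightarrow> (nat \<Rightarrow> 'v set) \<Rightarrow> bool" where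
  "natural_grading sv T N Vg \<longleftrightarrow>
     (\<exists>c. \<forall>j\<le>N. Vg j = {v. T v = sv (c + of_nat j) v})
     \<and> direct_sum {..N} Vg \<and> Vg 0 \<noteq> {0} \<and> Vg N \<noteq> {0}"

text \<open>
  The quotient of the \<open>P\<close>-representation \<open>\<rho>\<close> by the invariant subspace \<open>S\<close>, presented by its
  canonical projection \<open>q\<close>. The second conjunct determines the quotient up to isomorphism,
  the last one says that the action \<open>\<rho>h\<close> of \<open>P\<close> on it is the induced one.
\<close>

definition quotient_rep ::
  "'a set \<Rightarrow> ('l::real_normed_field \<Rightarrow> 'v::euclidean_space \<Rightarrow> 'v) \<Rightarrow> ('a \<Rightarrow> 'v \<Rightarrow> 'v) \<Rightarrow> 'v set \<Rightarrow>
   ('l \<Rightarrow> 'h::euclidean_space \<Rightarrow> 'h) \<Rightarrow> ('a \<Rightarrow> 'h \<Rightarrow> 'h) \<Rightarrow> ('v \<Rightarrow> 'h) \<Rightarrow> bool" where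
  "quotient_rep P sv \<rho> S sh \<rho>h q \<longleftrightarrow> scalar_mult sh
     \<and> (Vector_Spaces.linear sv sh q \<and> surj q \<and> {v. q v = 0} = S)
     \<and> (\<forall>a\<in>P. \<forall>v. \<rho>h a (q v) = q (\<rho> a v))"


section \<open>Parabolic geometries\<close>

definition principal_bundle ::
  "('a::{t2_space,second_countable_topology}, 'z) monoid_scheme \<Rightarrow> ('a, 'e::euclidean_space) chart set \<Rightarrow> 'a set \<Rightarrow>
   ('q::{t2_space,second_countable_topology}, 'eq::euclidean_space) chart set \<Rightarrow>
   ('m::{t2_space,second_countable_topology}, 'em::euclidean_space) chart set \<Rightarrow>
   ('q \<Rightarrow> 'm) \<Rightarrow> ('q \<Rightarrow> 'a \<Rightarrow> 'q) \<Rightarrow> bool" where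
  "principal_bundle G AG P AQ AM prj act \<longleftrightarrow>
     smooth_atlas AQ \<and> smooth_atlas AM \<and> smooth_on AQ AM UNIV prj
     \<and> (\<forall>u. act u \<one>\<^bsub>G\<^esub> = u)
     \<and> (\<forall>u. \<forall>a\<in>P. \<forall>b\<in>P. act (act u a) b = act u (a \<otimes>\<^bsub>G\<^esub> b))
     \<and> smooth_on (prod_atlas AQ AG) AQ (UNIV \<times> P) (\<lambda>(u, a). act u a)
     \<and> (\<forall>x. \<exists>U \<tau>. open U \<and> x \<in> U
          \<and> bij_betw \<tau> (prj -` U) (U \<times> P)
          \<and> smooth_on AQ (prod_atlas AM AG) (prj -` U) \<tau>
          \<and> smooth_on (prod_atlas AM AG) AQ (U \<times> P) (inv_into (prj -` U) \<tau>)
          \<and> (\<forall>u\<in>prj -` U. fst (\<tau> u) = prj u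
               \<and> (\<forall>a\<in>P. \<tau> (act u a) = (prj u, snd (\<tau> u) \<otimes>\<^bsub>G\<^esub> a))))"

text \<open>Fundamental vector fields: \<open>u \<mapsto> d/dt u \<cdot> exp (t A)\<close> at \<open>t = 0\<close>.\<close>

definition fundamental_field ::
  "('a::{t2_space,second_countable_topology}, 'z) monoid_scheme \<Rightarrow> ('a, 'e::euclidean_space) chart set \<Rightarrow>
   ('g::euclidean_space \<Rightarrow> 'a \<Rightarrow> 'a tvec) \<Rightarrow>
   ('q::{t2_space,second_countable_topology}, 'eq::euclidean_space) chart set \<Rightarrow>
   ('q \<Rightarrow> 'a \<Rightarrow> 'q) \<Rightarrow> 'g \<Rightarrow> 'q \<Rightarrow> 'q tvec" where
  "fundamental_field G AG L AQ act X u =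
     velocity AQ (\<lambda>t. act u (lie_exp G AG L (t *\<^sub>R X))) 0"

definition cartan_connection ::
  "nat \<Rightarrow> (int \<Rightarrow> 'g::euclidean_space set) \<Rightarrow>
   ('a::{t2_space,second_countable_topology}, 'z) monoid_scheme \<Rightarrow> ('a, 'e::euclidean_space) chart set \<Rightarrow>
   ('g \<Rightarrow> 'a \<Rightarrow> 'a tvec) \<Rightarrow> 'a set \<Rightarrow>
   ('q::{t2_space,second_countable_topology}, 'eq::euclidean_space) chart set \<Rightarrow>
   ('q \<Rightarrow> 'a \<Rightarrow> 'q) \<Rightarrow> ('q \<Rightarrow> 'q tvec \<Rightarrow> 'g) \<Rightarrow> bool" where
  "cartan_connection k gr G AG L P AQ act \<omega> \<longleftrightarrow>
     (\<forall>\<xi>. smooth_vector_field AQ \<xi> \<longrightarrow> smooth_fun AQ (\<lambda>u. \<omega> u (\<xi> u)))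
     \<and> (\<forall>u. bij_betw (\<omega> u) (tangent_space AQ u) UNIV
          \<and> (\<forall>D\<in>tangent_space AQ u. \<forall>D'\<in>tangent_space AQ u. \<omega> u (\<lambda>h. D h + D' h) = \<omega> u D + \<omega> u D')
          \<and> (\<forall>r. \<forall>D\<in>tangent_space AQ u. \<omega> u (\<lambda>h. r * D h) = r *\<^sub>R \<omega> u D))
     \<and> (\<forall>a\<in>P. \<forall>u. \<forall>D\<in>tangent_space AQ u.
          \<omega> (act u a) (pushforward AQ (\<lambda>u'. act u' a) D) = Ad G AG L (inv\<^bsub>G\<^esub> a) (\<omega> u D))
     \<and> (\<forall>X\<in>parabolic_subalgebra k gr. \<forall>u. \<omega> u (fundamental_field G AG L AQ act X u) = X)"

definition parabolic_geometry ::
  "nat \<Rightarrow> (int \<Rightarrow> 'g::euclidean_space set) \<Rightarrow>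
   ('a::{t2_space,second_countable_topology}, 'z) monoid_scheme \<Rightarrow> ('a, 'e::euclidean_space) chart set \<Rightarrow>
   ('g \<Rightarrow> 'a \<Rightarrow> 'a tvec) \<Rightarrow> 'a set \<Rightarrow>
   ('q::{t2_space,second_countable_topology}, 'eq::euclidean_space) chart set \<Rightarrow>
   ('m::{t2_space,second_countable_topology}, 'em::euclidean_space) chart set \<Rightarrow>
   ('q \<Rightarrow> 'm) \<Rightarrow> ('q \<Rightarrow> 'a \<Rightarrow> 'q) \<Rightarrow> ('q \<Rightarrow> 'q tvec \<Rightarrow> 'g) \<Rightarrow> bool" where
  "parabolic_geometry k gr G AG L P AQ AM prj act \<omega> \<longleftrightarrow>
     principal_bundle G AG P AQ AM prj act \<and> cartan_connection k gr G AG L P AQ act \<omega>"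

text \<open>The vector field \<open>\<omega>\<^sup>-\<^sup>1(X)\<close>, i.e. the one on which \<open>\<omega>\<close> is constantly \<open>X\<close>.\<close>

definition const_field ::
  "('q::{t2_space,second_countable_topology}, 'eq::euclidean_space) chart set \<Rightarrow>
   ('q \<Rightarrow> 'q tvec \<Rightarrow> 'g) \<Rightarrow> 'g \<Rightarrow> 'q \<Rightarrow> 'q tvec" where
  "const_field AQ \<omega> X u = inv_into (tangent_space AQ u) (\<omega> u) X"


section \<open>Associated bundles\<close>

text \<open>
  The class of \<open>(u, w)\<close> in the associated bundle. Elements of the bundle are such classes, and the
  class of \<open>(u, w)\<close> lies over \<open>prj u\<close>.
\<close>

definition assoc_class ::
  "('a, 'z) monoid_scheme \<Rightarrow> 'a set \<Rightarrow> ('q \<Rightarrow> 'a \<Rightarrow> 'q) \<Rightarrow> ('a \<Rightarrow> 'w \<Rightarrow> 'w) \<Rightarrow> 'q \<Rightarrow> 'w \<Rightarrow> ('q \<times> 'w) set" where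
  "assoc_class G P act \<rho> u w = {(act u a, \<rho> (inv\<^bsub>G\<^esub> a) w) | a. a \<in> P}"

text \<open>The \<open>P\<close>-equivariant function corresponding to a section.\<close>

definition section_fun ::
  "('a, 'z) monoid_scheme \<Rightarrow> 'a set \<Rightarrow> ('q \<Rightarrow> 'm) \<Rightarrow> ('q \<Rightarrow> 'a \<Rightarrow> 'q) \<Rightarrow> ('a \<Rightarrow> 'w \<Rightarrow> 'w) \<Rightarrow>
   ('m \<Rightarrow> ('q \<times> 'w) set) \<Rightarrow> 'q \<Rightarrow> 'w" where
  "section_fun G P prj act \<rho> s u = (THE w. s (prj u) = assoc_class G P act \<rho> u w)"

definition smooth_section ::
  "('a, 'z) monoid_scheme \<Rightarrow> 'a set \<Rightarrow> ('q::topological_space, 'eq::euclidean_space) chart set \<Rightarrow>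
   ('q \<Rightarrow> 'm) \<Rightarrow> ('q \<Rightarrow> 'a \<Rightarrow> 'q) \<Rightarrow> ('a \<Rightarrow> 'w \<Rightarrow> 'w::euclidean_space) \<Rightarrow> ('m \<Rightarrow> ('q \<times> 'w) set) \<Rightarrow> bool" where
  "smooth_section G P AQ prj act \<rho> s \<longleftrightarrow>
     (\<forall>x. \<exists>u w. prj u = x \<and> s x = assoc_class G P act \<rho> u w)
     \<and> smooth_fun AQ (section_fun G P prj act \<rho> s)"

text \<open>
  Fibrewise linear combination of elements \<open>F i\<close> of one fibre: the vector space operations on the
  fibre over \<open>prj u\<close> are those on second components of representatives with common first
  component \<open>u\<close>.
\<close>

definition fibre_lincomb ::
  "('l \<Rightarrow> 'w \<Rightarrow> 'w::comm_monoid_add) \<Rightarrow> 'i set \<Rightarrow> ('i \<Rightarrow> 'l) \<Rightarrow> ('i \<Rightarrow> ('q \<times> 'w) set) \<Rightarrow> ('q \<times> 'w) set" where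
  "fibre_lincomb s I c F = {(u, \<Sum>i\<in>I. s (c i) (w i)) | u w. \<forall>i\<in>I. (u, w i) \<in> F i}"

definition fibre_zero :: "('q \<Rightarrow> 'm) \<Rightarrow> 'm \<Rightarrow> ('q \<times> 'w::zero) set" where
  "fibre_zero prj x = {(u, 0) | u. prj u = x}"

text \<open>
  \<open>z\<close> is the value of \<open>\<nabla>\<^sub>\<xi> s\<close> at \<open>x\<close>. The formula does not depend on the choice of \<open>u\<close> over \<open>x\<close> and \<open>X\<close>
  with \<open>\<xi> = T\<^sub>uprj \<cdot> \<omega>\<^sub>u\<^sup>-\<^sup>1(X)\<close>, so this relation is functional in \<open>z\<close>.
\<close>

definition tractor_derivative ::
  "('a::{t2_space,second_countable_topology}, 'z) monoid_scheme \<Rightarrow>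
   ('g::euclidean_space \<Rightarrow> 'a \<Rightarrow> 'a tvec) \<Rightarrow> 'a set \<Rightarrow>
   ('q::{t2_space,second_countable_topology}, 'eq::euclidean_space) chart set \<Rightarrow>
   ('m::{t2_space,second_countable_topology}, 'em::euclidean_space) chart set \<Rightarrow>
   ('q \<Rightarrow> 'm) \<Rightarrow> ('q \<Rightarrow> 'a \<Rightarrow> 'q) \<Rightarrow> ('q \<Rightarrow> 'q tvec \<Rightarrow> 'g) \<Rightarrow> ('a \<Rightarrow> 'v::euclidean_space \<Rightarrow> 'v) \<Rightarrow>
   ('m \<Rightarrow> ('q \<times> 'v) set) \<Rightarrow> 'm \<Rightarrow> 'm tvec \<Rightarrow> ('q \<times> 'v) set \<Rightarrow> bool" where
  "tractor_derivative G L P AQ AM prj act \<omega> \<rho> s x \<xi> z \<longleftrightarrow>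
     (\<exists>u X. prj u = x \<and> \<xi> = pushforward AM prj (const_field AQ \<omega> X u)
       \<and> z = assoc_class G P act \<rho> u
           (dir_deriv (const_field AQ \<omega> X u) (section_fun G P prj act \<rho> s)
            + inf_action G L \<rho> X (section_fun G P prj act \<rho> s u)))"

definition parallel_section ::
  "('a::{t2_space,second_countable_topology}, 'z) monoid_scheme \<Rightarrow>
   ('g::euclidean_space \<Rightarrow> 'a \<Rightarrow> 'a tvec) \<Rightarrow> 'a set \<Rightarrow>
   ('q::{t2_space,second_countable_topology}, 'eq::euclidean_space) chart set \<Rightarrow>
   ('m::{t2_space,second_countable_topology}, 'em::euclidean_space) chart set \<Rightarrow>
   ('q \<Rightarrow> 'm) \<Rightarrow> ('q \<Rightarrow> 'a \<Rightarrow> 'q) \<Rightarrow> ('q \<Rightarrow> 'q tvec \<Rightarrow> 'g) \<Rightarrow> ('a \<Rightarrow> 'v::euclidean_space \<Rightarrow> 'v) \<Rightarrow>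
   ('m \<Rightarrow> ('q \<times> 'v) set) \<Rightarrow> bool" where
  "parallel_section G L P AQ AM prj act \<omega> \<rho> s \<longleftrightarrow>
     smooth_section G P AQ prj act \<rho> s
     \<and> (\<forall>x \<xi> z. tractor_derivative G L P AQ AM prj act \<omega> \<rho> s x \<xi> z \<longrightarrow> z = fibre_zero prj x)"

text \<open>
  The bundle map \<open>\<Pi>\<close> induced by \<open>q\<close> sends the class of \<open>(u, v)\<close> to the class of \<open>(u, q v)\<close>, which is
  the image set under \<open>(u, v) \<mapsto> (u, q v)\<close>.
\<close>

definition bundle_projection :: "('v \<Rightarrow> 'h) \<Rightarrow> ('q \<times> 'v) set \<Rightarrow> ('q \<times> 'h) set" where
  "bundle_projection q z = map_prod id q ` z"

definition normal_solution ::
  "('a::{t2_space,second_countable_topology}, 'z) monoid_scheme \<Rightarrow>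
   ('g::euclidean_space \<Rightarrow> 'a \<Rightarrow> 'a tvec) \<Rightarrow> 'a set \<Rightarrow>
   ('q::{t2_space,second_countable_topology}, 'eq::euclidean_space) chart set \<Rightarrow>
   ('m::{t2_space,second_countable_topology}, 'em::euclidean_space) chart set \<Rightarrow>
   ('q \<Rightarrow> 'm) \<Rightarrow> ('q \<Rightarrow> 'a \<Rightarrow> 'q) \<Rightarrow> ('q \<Rightarrow> 'q tvec \<Rightarrow> 'g) \<Rightarrow> ('a \<Rightarrow> 'v::euclidean_space \<Rightarrow> 'v) \<Rightarrow>
   ('a \<Rightarrow> 'h::euclidean_space \<Rightarrow> 'h) \<Rightarrow> ('v \<Rightarrow> 'h) \<Rightarrow> ('m \<Rightarrow> ('q \<times> 'h) set) \<Rightarrow> bool" where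
  "normal_solution G L P AQ AM prj act \<omega> \<rho> \<rho>h q \<alpha> \<longleftrightarrow>
     smooth_section G P AQ prj act \<rho>h \<alpha>
     \<and> (\<exists>s. parallel_section G L P AQ AM prj act \<omega> \<rho> s \<and> (\<forall>x. \<alpha> x = bundle_projection q (s x)))"


section \<open>Normal coordinates and frames\<close>

definition normal_lift ::
  "('q::{t2_space,second_countable_topology}, 'eq::euclidean_space) chart set \<Rightarrow>
   ('q \<Rightarrow> 'q tvec \<Rightarrow> 'g) \<Rightarrow> 'q \<Rightarrow> 'g \<Rightarrow> 'q" where
  "normal_lift AQ \<omega> u0 X = flow AQ (const_field AQ \<omega> X) 1 u0"

definition normal_param ::
  "('q::{t2_space,second_countable_topology}, 'eq::euclidean_space) chart set \<Rightarrow>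
   ('q \<Rightarrow> 'm) \<Rightarrow> ('q \<Rightarrow> 'q tvec \<Rightarrow> 'g) \<Rightarrow> 'q \<Rightarrow> 'g \<Rightarrow> 'm" where
  "normal_param AQ prj \<omega> u0 X = prj (normal_lift AQ \<omega> u0 X)"

text \<open>
  \<open>V\<close> is an open neighbourhood of \<open>0\<close> in \<open>gm\<close> on which the flows exist up to time \<open>1\<close> and
  which \<open>normal_param\<close> maps diffeomorphically onto an open subset of the base.
\<close>

definition normal_domain ::
  "('q::{t2_space,second_countable_topology}, 'eq::euclidean_space) chart set \<Rightarrow>
   ('m::{t2_space,second_countable_topology}, 'em::euclidean_space) chart set \<Rightarrow>
   ('q \<Rightarrow> 'm) \<Rightarrow> ('q \<Rightarrow> 'q tvec \<Rightarrow> 'g::euclidean_space) \<Rightarrow> 'q \<Rightarrow> 'g set \<Rightarrow> 'g set \<Rightarrow> bool" where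
  "normal_domain AQ AM prj \<omega> u0 gm V \<longleftrightarrow>
     openin (top_of_set gm) V \<and> 0 \<in> V
     \<and> (\<forall>X\<in>V. \<exists>u. flows_to AQ (const_field AQ \<omega> X) 1 u0 u)
     \<and> inj_on (normal_param AQ prj \<omega> u0) V
     \<and> open (normal_param AQ prj \<omega> u0 ` V)
     \<and> smooth_on std_atlas AM V (normal_param AQ prj \<omega> u0)
     \<and> smooth_on AM std_atlas (normal_param AQ prj \<omega> u0 ` V) (inv_into V (normal_param AQ prj \<omega> u0))"

definition normal_chart ::
  "('q::{t2_space,second_countable_topology}, 'eq::euclidean_space) chart set \<Rightarrow>
   ('q \<Rightarrow> 'm) \<Rightarrow> ('q \<Rightarrow> 'q tvec \<Rightarrow> 'g) \<Rightarrow> 'q \<Rightarrow> 'g set \<Rightarrow> 'm \<Rightarrow> 'g" where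
  "normal_chart AQ prj \<omega> u0 V = inv_into V (normal_param AQ prj \<omega> u0)"

definition normal_section ::
  "('q::{t2_space,second_countable_topology}, 'eq::euclidean_space) chart set \<Rightarrow>
   ('q \<Rightarrow> 'm) \<Rightarrow> ('q \<Rightarrow> 'q tvec \<Rightarrow> 'g) \<Rightarrow> 'q \<Rightarrow> 'g set \<Rightarrow> 'm \<Rightarrow> 'q" where
  "normal_section AQ prj \<omega> u0 V x = normal_lift AQ \<omega> u0 (normal_chart AQ prj \<omega> u0 V x)"

text \<open>The coordinate, in the normal chart, belonging to the element \<open>b\<close> of a basis \<open>B\<close>.\<close>

definition normal_coord ::
  "('q::{t2_space,second_countable_topology}, 'eq::euclidean_space) chart set \<Rightarrow>
   ('q \<Rightarrow> 'm) \<Rightarrow> ('q \<Rightarrow> 'q tvec \<Rightarrow> 'g::euclidean_space) \<Rightarrow> 'q \<Rightarrow> 'g set \<Rightarrow> 'g set \<Rightarrow> 'g \<Rightarrow> 'm \<Rightarrow> real" where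
  "normal_coord AQ prj \<omega> u0 V B b x = real_vector.representation B (normal_chart AQ prj \<omega> u0 V x) b"

definition normal_frame ::
  "('a, 'z) monoid_scheme \<Rightarrow> 'a set \<Rightarrow> ('q \<Rightarrow> 'a \<Rightarrow> 'q) \<Rightarrow> ('a \<Rightarrow> 'w \<Rightarrow> 'w) \<Rightarrow> ('m \<Rightarrow> 'q) \<Rightarrow>
   'w \<Rightarrow> 'm \<Rightarrow> ('q \<times> 'w) set" where
  "normal_frame G P act \<rho> \<sigma> w x = assoc_class G P act \<rho> (\<sigma> x) w"

text \<open>The coefficients of \<open>\<alpha>\<close> in a frame \<open>F\<close> indexed by \<open>I\<close>.\<close>

definition frame_coeff ::
  "('l::zero \<Rightarrow> 'w \<Rightarrow> 'w::comm_monoid_add) \<Rightarrow> 'i set \<Rightarrow> ('i \<Rightarrow> 'm \<Rightarrow> ('q \<times> 'w) set) \<Rightarrow>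
   ('m \<Rightarrow> ('q \<times> 'w) set) \<Rightarrow> 'i \<Rightarrow> 'm \<Rightarrow> 'l" where
  "frame_coeff s I F \<alpha> i x =
     (THE c. (\<forall>j. j \<notin> I \<longrightarrow> c j = 0) \<and> \<alpha> x = fibre_lincomb s I c (\<lambda>j. F j x)) i"

text \<open>
  On \<open>U\<close>, the function \<open>f\<close> is a polynomial of degree at most \<open>N\<close> in the real functions \<open>y i\<close>, \<open>i \<in> I\<close>; the
  sum is over the multi-indices \<open>m\<close> of order at most \<open>N\<close>.
\<close>

definition polynomial_of_degree_le_on ::
  "'m set \<Rightarrow> nat \<Rightarrow> 'i set \<Rightarrow> ('i \<Rightarrow> 'm \<Rightarrow> real) \<Rightarrow> ('m \<Rightarrow> 'l::real_normed_field) \<Rightarrow> bool" where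
  "polynomial_of_degree_le_on U N I y f \<longleftrightarrow>
     (\<exists>c. \<forall>x\<in>U. f x =
        (\<Sum>m\<in>{m :: 'i \<Rightarrow> nat. (\<forall>i. i \<notin> I \<longrightarrow> m i = 0) \<and> (\<Sum>i\<in>I. m i) \<le> N}.
           c m * of_real (\<Prod>i\<in>I. y i x ^ m i)))"

end

theory Submission
  imports Defs
begin

text \<open>
  Let \<open>\<alpha> = \<Pi>(s)\<close> with \<open>s\<close> parallel, and let \<open>f\<close> be the equivariant function of \<open>s\<close>. That \<open>s\<close> is parallel
  means that \<open>\<omega>\<^sup>-\<^sup>1(X)\<close> differentiates \<open>f\<close> to \<open>- X \<cdot> f\<close> for every \<open>X\<close>. The normal section reaches the point with
  normal coordinates \<open>X\<close> along the flow of \<open>\<omega>\<^sup>-\<^sup>1(X)\<close> from \<open>u0\<close>, and on this curve \<open>f\<close> solves a linear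
  differential equation with constant coefficients. Hence \<open>f (\<sigma> x) = exp (-X) (f u0)\<close>
  (\<open>parallel_section_along_flow\<close>).

  An element \<open>X\<close> of \<open>g\<^sub>-\<close> lowers the degree in the representation, because \<open>[E, X]\<close> acts as the
  commutator (\<open>dact_bracket\<close>) and there is nothing below degree \<open>0\<close>. So its \<open>(N + 1)\<close>-st power acts by
  zero (\<open>g_minus_nilpotent\<close>), and the exponential is the sum of \<open>(-1)\<^sup>n / n! X\<^sup>n (f u0)\<close> over \<open>n \<le> N\<close>. Since
  the action is linear in \<open>X\<close>, the \<open>n\<close>-th term is homogeneous of degree \<open>n\<close> in the coordinates of \<open>X\<close>
  (\<open>polynomial_linear_power\<close>).

  The coefficient of \<open>\<alpha>\<close> at a vector of the frame is a real-linear function of \<open>f (\<sigma> x)\<close>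
  (\<open>frame_coeff_normal_frame\<close>), hence a polynomial of degree at most \<open>N\<close> as well.
\<close>


section \<open>Smooth functions and tangent vectors\<close>

lemma Ck_on_cong:
  assumes "open S" "\<And>x. x \<in> S \<Longrightarrow> f x = g x"
  shows "Ck_on n S f \<longleftrightarrow> Ck_on n S g"
  using assms
proof (induction n arbitrary: f g)
  case 0
  then have "continuous_on S f \<longleftrightarrow> continuous_on S g" by (intro continuous_on_cong) auto
  then show ?case by simp
next
  case (Suc n)
  have "(g' has_derivative d) (at x)"
    if "x \<in> S" "(f' has_derivative d) (at x)" "\<And>y. y \<in> S \<Longrightarrow> f' y = g' y" for x d f' g'
    using that Suc.prems(1) by (blast intro: has_derivative_transform_within_open)
  then have D: "(f has_derivative d) (at x) \<longleftrightarrow> (g has_derivative d) (at x)" if "x \<in> S" for x d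
    using that Suc.prems(2) by metis
  have "f differentiable (at x) \<longleftrightarrow> g differentiable (at x)" if "x \<in> S" for x
    using D[OF that] by (simp add: differentiable_def)
  moreover have "Ck_on n S (\<lambda>x. frechet_derivative f (at x) v)
      \<longleftrightarrow> Ck_on n S (\<lambda>x. frechet_derivative g (at x) v)" for v
    using D by (intro Suc.IH Suc.prems) (simp add: frechet_derivative_def)
  ultimately show ?case by simp
qed

text \<open>
  A bounded linear map commutes with every directional derivative. The two derivatives agree only on
  \<open>S\<close>, so the induction needs that \<open>Ck_on\<close> on an open set sees a function only there.
\<close>

lemma Ck_on_bounded_linear_compose:
  assumes "open S" "bounded_linear l" "Ck_on n S f"
  shows "Ck_on n S (\<lambda>x. l (f x))"
  using assms(3)
proof (induction n arbitrary: f)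
  case 0
  then show ?case using assms(2) by (simp add: bounded_linear.continuous_on)
next
  case (Suc n)
  have D: "((\<lambda>x. l (f x)) has_derivative (\<lambda>v. l (frechet_derivative f (at x) v))) (at x)"
    if "x \<in> S" for x
    using Suc.prems that
    by (intro bounded_linear.has_derivative[OF assms(2)]) (simp add: frechet_derivative_works)
  have "Ck_on n S (\<lambda>x. frechet_derivative (\<lambda>x. l (f x)) (at x) v)
      \<longleftrightarrow> Ck_on n S (\<lambda>x. l (frechet_derivative f (at x) v))" for v
    by (intro Ck_on_cong assms(1)) (simp add: frechet_derivative_at[OF D, symmetric])
  with Suc D show ?case by (auto simp: differentiable_def)
qed

lemma smooth_fun_bounded_linear_compose:
  assumes "smooth_fun A f" "bounded_linear l"
  shows "smooth_fun A (\<lambda>x. l (f x))"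
  unfolding smooth_fun_def smooth_on_def
proof
  fix x
  obtain O' F where F: "x \<in> O'" "smooth_open_on A std_atlas O' F" "\<forall>y\<in>O' \<inter> UNIV. F y = f y"
    using assms(1) unfolding smooth_fun_def smooth_on_def by blast
  have "smooth_open_on A std_atlas O' (\<lambda>y. l (F y))"
    using F(2) Ck_on_bounded_linear_compose[OF _ assms(2)]
      bounded_linear.continuous_on[OF assms(2)]
    unfolding smooth_open_on_def std_atlas_def C_infty_on_def by (fastforce simp: comp_def)
  with F show "\<exists>O' F. x \<in> O' \<and> smooth_open_on A std_atlas O' F \<and> (\<forall>y\<in>O' \<inter> UNIV. F y = l (f y))"
    by (intro exI[of _ O'] exI[of _ "\<lambda>y. l (F y)"]) auto
qed

lemma smooth_fun_inner:
  assumes "smooth_fun A f"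
  shows "smooth_fun A (\<lambda>x. f x \<bullet> w)"
  by (rule smooth_fun_bounded_linear_compose[OF assms bounded_linear_inner_left])

text \<open>
  A tangent vector is only known to be linear on smooth functions. Since \<open>F x \<bullet> w\<close> is smooth
  in \<open>x\<close> for every \<open>w\<close>, linearity in \<open>w\<close> turns the definition of \<open>dir_deriv\<close> by means of the
  basis into a description that refers to no basis; the rules for \<open>dir_deriv\<close> then follow by
  testing against all \<open>w\<close>.
\<close>

lemma inner_dir_deriv:
  assumes D: "D \<in> tangent_space A x" and F: "smooth_fun A F"
  shows "dir_deriv D F \<bullet> w = D (\<lambda>y. F y \<bullet> w)"
proof -
  have lin: "linear (\<lambda>w. D (\<lambda>y. F y \<bullet> w))"
    using D smooth_fun_inner[OF F] unfolding tangent_space_def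
    by (intro linearI) (auto simp: inner_add_right)
  then have "D (\<lambda>y. F y \<bullet> (\<Sum>b\<in>Basis. (w \<bullet> b) *\<^sub>R b))
      = (\<Sum>b\<in>Basis. (w \<bullet> b) *\<^sub>R D (\<lambda>y. F y \<bullet> b))"
    by (simp only: linear_sum[OF lin] linear_scale[OF lin])
  then show ?thesis
    unfolding euclidean_representation dir_deriv_def
    by (simp only: inner_sum_left inner_scaleR_left inner_commute[of w] real_scaleR_def mult.commute)
qed

text \<open>
  Testing against \<open>w\<close> moves the linear map to the other side of the inner product, as its adjoint.
\<close>

lemma dir_deriv_linear_compose:
  assumes D: "D \<in> tangent_space A x" and F: "smooth_fun A F" and l: "linear l"
  shows "dir_deriv D (\<lambda>y. l (F y)) = l (dir_deriv D F)"
proof (rule vector_eq_rdot[THEN iffD1], intro allI)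
  fix w
  have "dir_deriv D (\<lambda>y. l (F y)) \<bullet> w = D (\<lambda>y. l (F y) \<bullet> w)"
    using l by (intro inner_dir_deriv[OF D] smooth_fun_bounded_linear_compose[OF F])
      (simp add: linear_conv_bounded_linear)
  also have "\<dots> = dir_deriv D F \<bullet> adjoint l w"
    by (subst inner_dir_deriv[OF D F]) (simp add: adjoint_works[OF l])
  finally show "dir_deriv D (\<lambda>y. l (F y)) \<bullet> w = l (dir_deriv D F) \<bullet> w"
    by (simp add: adjoint_works[OF l])
qed

lemma dir_deriv_add:
  assumes "D \<in> tangent_space A x" "smooth_fun A F" "smooth_fun A F'"
  shows "dir_deriv D (\<lambda>y. F y + F' y) = dir_deriv D F + dir_deriv D F'"
  using assms smooth_fun_inner[of A F] smooth_fun_inner[of A F']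
  by (simp add: dir_deriv_def tangent_space_def inner_add_left scaleR_add_left sum.distrib)


section \<open>The infinitesimal representation\<close>

lemma scalar_mult_linear:
  assumes "scalar_mult s"
  shows "linear (s a)"
proof -
  interpret vector_space s using assms by (simp add: scalar_mult_def)
  have "s (of_real r) v = r *\<^sub>R v" for r v using assms by (simp add: scalar_mult_def)
  then show ?thesis
    by (intro linearI) (metis scale_right_distrib, metis scale_left_commute)
qed

lemma scalar_linear_imp_linear:
  assumes "scalar_mult s" "scalar_mult s'" "Vector_Spaces.linear s s' f"
  shows "linear f"
  using assms unfolding scalar_mult_def Vector_Spaces.linear_def module_hom_def
    module_hom_axioms_def
  by (intro linearI) (auto, metis)

locale lie_group_representation =
  fixes G :: "('a::{t2_space,second_countable_topology}, 'z) monoid_scheme"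
    and AG :: "('a, 'e::euclidean_space) chart set"
    and br :: "'g::euclidean_space \<Rightarrow> 'g \<Rightarrow> 'g"
    and L :: "'g \<Rightarrow> 'a \<Rightarrow> 'a tvec"
    and sv :: "'l::real_normed_field \<Rightarrow> 'v::euclidean_space \<Rightarrow> 'v"
    and \<rho> :: "'a \<Rightarrow> 'v \<Rightarrow> 'v"
  assumes lie_group: "lie_group G AG"
    and lie_algebra_of: "lie_algebra_of G AG br L"
    and representation: "representation_of G AG sv \<rho>"
begin

abbreviation dact (infixr "\<cdot>" 75) where "X \<cdot> v \<equiv> inf_action G L \<rho> X v"

lemma scalars: "scalar_mult sv"
  using representation by (simp add: representation_of_def)

lemma rep_linear: "linear (\<rho> a)"
  using representation scalar_linear_imp_linear[OF scalars scalars]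
  by (simp add: representation_of_def)

lemma rep_smooth: "smooth_fun AG (\<lambda>a. \<rho> a v)"
  using representation by (simp add: representation_of_def)

lemma left_invariant_field_tangent: "L X a \<in> tangent_space AG a"
  using lie_algebra_of by (simp add: lie_algebra_of_def smooth_vector_field_def)

lemma inner_dact: "(X \<cdot> v) \<bullet> w = L X \<one>\<^bsub>G\<^esub> (\<lambda>a. \<rho> a v \<bullet> w)"
  unfolding inf_action_def by (rule inner_dir_deriv[OF left_invariant_field_tangent rep_smooth])

text \<open>
  The eigenvalues of the grading element are scalars of the representation and possibly not real, so
  the infinitesimal action has to commute with all scalars.
\<close>

lemma dact_scalar: "X \<cdot> sv r v = sv r (X \<cdot> v)"
proof -
  have "\<rho> a (sv r v) = sv r (\<rho> a v)" for a
    using representation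
    by (simp add: representation_of_def Vector_Spaces.linear_def module_hom_def
        module_hom_axioms_def)
  then show ?thesis
    using dir_deriv_linear_compose[OF left_invariant_field_tangent rep_smooth
        scalar_mult_linear[OF scalars]]
    by (simp add: inf_action_def)
qed

lemma dact_linear: "linear (dact X)"
proof (rule linearI)
  show "X \<cdot> (v + w) = X \<cdot> v + X \<cdot> w" for v w
    using dir_deriv_add[OF left_invariant_field_tangent rep_smooth rep_smooth]
    by (simp add: inf_action_def linear_add[OF rep_linear])
  show "X \<cdot> (r *\<^sub>R v) = r *\<^sub>R (X \<cdot> v)" for r v
    using dact_scalar[of X "of_real r" v] scalars by (simp add: scalar_mult_def)
qed

lemma dact_linear_left: "linear (\<lambda>X. X \<cdot> v)"
  using lie_algebra_of
  by (intro linearI)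
    (simp_all add: inf_action_def dir_deriv_def lie_algebra_of_def scaleR_add_left sum.distrib
      scaleR_sum_right)

text \<open>
  Left invariance of the field of \<open>Y\<close> shows that it differentiates the matrix coefficient
  \<open>a \<mapsto> \<rho> a v \<bullet> w\<close> into the matrix coefficient of \<open>Y \<cdot> v\<close>. Hence the commutator of two such fields
  acts on matrix coefficients as the commutator of the two endomorphisms.
\<close>

lemma left_invariant_field_coefficient:
  "L Y a (\<lambda>b. \<rho> b v \<bullet> w) = \<rho> a (Y \<cdot> v) \<bullet> w"
proof -
  interpret Group.group G using lie_group by (simp add: lie_group_def)
  have carrier: "carrier G = UNIV" using lie_group by (simp add: lie_group_def)
  have mult: "\<rho> (a \<otimes>\<^bsub>G\<^esub> b) v = \<rho> a (\<rho> b v)" for a b v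
    using representation by (simp add: representation_of_def)
  have "L Y a = pushforward AG (\<lambda>y. a \<otimes>\<^bsub>G\<^esub> y) (L Y \<one>\<^bsub>G\<^esub>)"
    using lie_algebra_of carrier by (simp add: lie_algebra_of_def)
  then have "L Y a (\<lambda>b. \<rho> b v \<bullet> w) = L Y \<one>\<^bsub>G\<^esub> (\<lambda>b. \<rho> a (\<rho> b v) \<bullet> w)"
    using smooth_fun_inner[OF rep_smooth] by (simp add: pushforward_def comp_def mult)
  also have "\<dots> = (Y \<cdot> v) \<bullet> adjoint (\<rho> a) w"
    unfolding inner_dact by (simp add: adjoint_works[OF rep_linear])
  finally show ?thesis by (simp add: adjoint_works[OF rep_linear])
qed

lemma dact_bracket: "br X Y \<cdot> v = X \<cdot> Y \<cdot> v - Y \<cdot> X \<cdot> v"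
proof (rule vector_eq_rdot[THEN iffD1], intro allI)
  fix w
  have "L (br X Y) \<one>\<^bsub>G\<^esub> (\<lambda>a. \<rho> a v \<bullet> w)
      = L X \<one>\<^bsub>G\<^esub> (\<lambda>b. L Y b (\<lambda>a. \<rho> a v \<bullet> w)) - L Y \<one>\<^bsub>G\<^esub> (\<lambda>b. L X b (\<lambda>a. \<rho> a v \<bullet> w))"
    using lie_algebra_of smooth_fun_inner[OF rep_smooth] by (simp add: lie_algebra_of_def)
  then show "(br X Y \<cdot> v) \<bullet> w = (X \<cdot> Y \<cdot> v - Y \<cdot> X \<cdot> v) \<bullet> w"
    by (simp only: left_invariant_field_coefficient[of _ _ "_ \<cdot> _"] left_invariant_field_coefficient
        inner_diff_left inner_dact)
qed

end


section \<open>Negative elements act nilpotently\<close>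

text \<open>
  Up to the shift \<open>c\<close>, the eigenvalues of \<open>T\<close> are exhausted by the degrees \<open>0, \<dots>, N\<close>, so there is no
  eigenvector of negative degree: compare components in the direct sum.
\<close>

lemma natural_grading_no_negative_degree:
  assumes sv: "scalar_mult sv" and T: "linear T" "\<And>r v. T (sv r v) = sv r (T v)"
    and eig: "\<And>j. j \<le> N \<Longrightarrow> Vg j = {v. T v = sv (c + of_nat j) v}"
    and sum: "direct_sum {..N} Vg"
    and w: "T w = sv (c + of_int d) w" and d: "d < 0"
  shows "w = 0"
proof -
  interpret vs: vector_space sv using sv by (simp add: scalar_mult_def)
  obtain x where x: "\<forall>i\<in>{..N}. x i \<in> Vg i" "\<forall>i. i \<notin> {..N} \<longrightarrow> x i = 0" "w = (\<Sum>i\<in>{..N}. x i)"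
    using sum unfolding direct_sum_def by metis
  have "T w = (\<Sum>i\<in>{..N}. T (x i))" using x(3) by (simp add: linear_sum[OF T(1)])
  also have "\<dots> = (\<Sum>i\<in>{..N}. sv (c + of_nat i) (x i))"
    using x(1) eig by (intro sum.cong) auto
  finally have "0 = (\<Sum>i\<in>{..N}. sv (c + of_nat i) (x i)) - sv (c + of_int d) w"
    using w by simp
  also have "\<dots> = (\<Sum>i\<in>{..N}. sv (of_int (int i - d)) (x i))"
    unfolding x(3) by (simp add: vs.scale_sum_right flip: sum_subtractf vs.scale_left_diff_distrib)
  finally have zero: "0 = (\<Sum>i\<in>{..N}. sv (of_int (int i - d)) (x i))" .
  have mem: "sv \<mu> (x i) \<in> Vg i" if "i \<le> N" for i \<mu>
  proof -
    have "T (x i) = sv (c + of_nat i) (x i)" using x(1) eig[OF that] that by auto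
    then show ?thesis by (simp add: eig[OF that] T(2) vs.scale_left_commute)
  qed
  have "(\<lambda>i. sv (of_int (int i - d)) (x i)) = (\<lambda>i. 0)"
  proof (rule ex1E[OF sum[unfolded direct_sum_def, rule_format, of 0]])
    fix y assume y: "\<forall>z. (\<forall>i\<in>{..N}. z i \<in> Vg i) \<and> (\<forall>i. i \<notin> {..N} \<longrightarrow> z i = 0)
        \<and> 0 = (\<Sum>i\<in>{..N}. z i) \<longrightarrow> z = y"
    have "(\<lambda>i. sv (of_int (int i - d)) (x i)) = y"
      using mem zero x(2) by (intro y[rule_format]) auto
    moreover have "(\<lambda>i. 0) = y"
      using eig linear_0[OF T(1)] by (intro y[rule_format]) auto
    ultimately show ?thesis by simp
  qed
  then have "sv (of_int (int i - d)) (x i) = 0" for i by metis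
  moreover have "(of_int (int i - d) :: 'a) \<noteq> 0" for i
    using d by (simp only: of_int_eq_0_iff)
  ultimately have "x i = 0" for i by (metis vs.scale_eq_0_iff)
  then show ?thesis using x(3) by simp
qed

context lie_group_representation
begin

text \<open>
  If \<open>[E, X] = i X\<close>, then \<open>X\<close> shifts eigenvalues of \<open>E\<close> by \<open>i\<close>. Thus elements of negative degree
  lower the filtration of the representation by degree.
\<close>

lemma g_minus_lowers_filtration:
  assumes E: "grading_element br gr E"
    and grading: "natural_grading sv (dact E) N Vg"
    and X: "X \<in> g_minus k gr" and m: "m \<le> N" and v: "v \<in> span (\<Union>j<Suc m. Vg j)"
  shows "X \<cdot> v \<in> span (\<Union>j<m. Vg j)"
proof -
  interpret vs: vector_space sv using scalars by (simp add: scalar_mult_def)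
  obtain c where eig: "\<And>j. j \<le> N \<Longrightarrow> Vg j = {v. E \<cdot> v = sv (c + of_nat j) v}"
    and sum: "direct_sum {..N} Vg"
    using grading unfolding natural_grading_def by blast
  have homogeneous: "Y \<cdot> v \<in> span (\<Union>j<m. Vg j)"
    if Y: "Y \<in> gr i" and i: "i < 0" and v: "v \<in> Vg j" and j: "j \<le> m" for Y i v j
  proof -
    have "br E Y = of_int i *\<^sub>R Y" using E Y by (simp add: grading_element_def)
    then have "E \<cdot> Y \<cdot> v = of_int i *\<^sub>R (Y \<cdot> v) + Y \<cdot> E \<cdot> v"
      using dact_bracket[of E Y v] by (simp add: linear_scale[OF dact_linear_left])
    also have "E \<cdot> v = sv (c + of_nat j) v" using v j m eig by simp
    also have "of_int i *\<^sub>R (Y \<cdot> v) = sv (of_int i) (Y \<cdot> v)"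
      using scalars unfolding scalar_mult_def by (metis of_real_of_int_eq)
    finally have *: "E \<cdot> Y \<cdot> v = sv (c + of_int (int j + i)) (Y \<cdot> v)"
      by (simp add: dact_scalar vs.scale_left_distrib linear_add[OF dact_linear])
    show ?thesis
    proof (cases "int j + i < 0")
      case True
      then have "Y \<cdot> v = 0"
        using natural_grading_no_negative_degree[OF scalars dact_linear dact_scalar eig sum *]
        by blast
      then show ?thesis by (simp add: span_zero)
    next
      case False
      define j' where "j' = nat (int j + i)"
      have j': "int j + i = int j'" "j' < m" using False i j by (auto simp: j'_def)
      with * eig[of j'] m have "Y \<cdot> v \<in> Vg j'" by simp
      then show ?thesis using j' by (intro span_base) auto
    qed
  qed
  obtain x where x: "X = (\<Sum>i\<in>{- int k..-1}. x i)" "\<forall>i\<in>{- int k..-1}. x i \<in> gr i"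
    using X unfolding g_minus_def graded_part_def by blast
  have "dact X ` (\<Union>j<Suc m. Vg j) \<subseteq> span (\<Union>j<m. Vg j)"
  proof clarsimp
    fix j u assume "u \<in> Vg j" "j < Suc m"
    then show "X \<cdot> u \<in> span (\<Union>j<m. Vg j)"
      using x(2) unfolding x(1) linear_sum[OF dact_linear_left]
      by (intro span_sum homogeneous) auto
  qed
  then have "span (dact X ` (\<Union>j<Suc m. Vg j)) \<subseteq> span (\<Union>j<m. Vg j)"
    by (simp add: span_minimal)
  then show ?thesis using v linear_span_image[OF dact_linear] by blast
qed

text \<open>
  The whole representation is the top step of the filtration, the bottom step is \<open>0\<close>, and there are
  \<open>N + 1\<close> steps between them.
\<close>

lemma g_minus_nilpotent:
  assumes E: "grading_element br gr E"
    and grading: "natural_grading sv (dact E) N Vg"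
    and X: "X \<in> g_minus k gr"
  shows "(dact X ^^ Suc N) v = 0"
proof -
  have "(dact X ^^ n) v \<in> span (\<Union>j<Suc N - n. Vg j)" if "n \<le> Suc N" for n
    using that
  proof (induction n)
    case 0
    obtain x where "\<forall>i\<in>{..N}. x i \<in> Vg i" "v = (\<Sum>i\<in>{..N}. x i)"
      using grading unfolding natural_grading_def direct_sum_def by metis
    then show ?case
      by (simp, intro span_sum span_base) auto
  next
    case (Suc n)
    then have "Suc N - n = Suc (N - n)" by simp
    then show ?case
      using Suc g_minus_lowers_filtration[OF E grading X, of "N - n" "(dact X ^^ n) v"] by simp
  qed
  from this[of "Suc N"] show ?thesis by simp
qed

end


section \<open>Linear differential equations with nilpotent coefficients\<close>

lemma linear_funpow:
  fixes A :: "'v::real_vector \<Rightarrow> 'v"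
  assumes "linear A"
  shows "linear (A ^^ n)"
  by (induction n)
    (use assms linear_compose[of _ A] in \<open>auto simp: comp_def linear_id[unfolded id_def]\<close>)

text \<open>
  The solution is \<open>exp (-A) (g 0)\<close>. No exponential has to be inverted: the finite sum for
  \<open>exp ((t - 1) A) (g t)\<close> is constant in \<open>t\<close>, and it reduces to \<open>g 1\<close> at \<open>t = 1\<close>.
\<close>

lemma nilpotent_linear_ode:
  fixes A :: "'v::euclidean_space \<Rightarrow> 'v"
  assumes g: "\<And>t. t \<in> {0..1} \<Longrightarrow> (g has_vector_derivative - A (g t)) (at t)"
    and A: "linear A" and nilpotent: "\<And>v. (A ^^ Suc N) v = 0"
  shows "g 1 = (\<Sum>n\<le>N. ((-1) ^ n / fact n) *\<^sub>R (A ^^ n) (g 0))"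
proof -
  note An = linear_funpow[OF A]
  define h where "h t = (\<Sum>n\<le>N. ((t - 1) ^ n / fact n) *\<^sub>R (A ^^ n) (g t))" for t
  define h' where "h' n t = ((t - 1) ^ n / fact n) *\<^sub>R (A ^^ n) (- A (g t))
      + (of_nat n * (t - 1) ^ (n - 1) / fact n) *\<^sub>R (A ^^ n) (g t)" for n t
  \<comment> \<open>the first term of \<open>h' n\<close> cancels the second one of \<open>h' (n + 1)\<close>; what remains contains \<open>A ^^ (N + 1)\<close>\<close>
  have telescope: "(\<Sum>n\<le>M. h' n t) = - (((t - 1) ^ M / fact M) *\<^sub>R (A ^^ Suc M) (g t))" for M t
  proof (induction M)
    case 0
    then show ?case by (simp add: h'_def)
  next
    case (Suc M)
    have "(real (Suc M) * (t - 1) ^ M / fact (Suc M)) = (t - 1) ^ M / fact M"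
      by (simp del: of_nat_Suc)
    with Suc show ?case
      by (simp add: h'_def linear_neg[OF An] linear_neg[OF A] funpow_swap1 del: of_nat_Suc)
  qed
  have "(h has_vector_derivative (\<Sum>n\<le>N. h' n t)) (at t within {0..1})" if "t \<in> {0..1}" for t
  proof -
    have "((\<lambda>t. (A ^^ n) (g t)) has_vector_derivative (A ^^ n) (- A (g t))) (at t within {0..1})" for n
      using bounded_linear.has_vector_derivative[OF _ g[OF that]] An
      by (auto simp: linear_conv_bounded_linear intro: has_vector_derivative_at_within)
    moreover have "((\<lambda>t. (t - 1) ^ n / fact n) has_real_derivative
        of_nat n * (t - 1) ^ (n - 1) / fact n) (at t within {0..1})" for n
      by (auto intro!: derivative_eq_intros)
    ultimately show ?thesis
      unfolding h_def h'_def
      by (intro has_vector_derivative_sum has_vector_derivative_scaleR)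
  qed
  then have "(h has_vector_derivative 0) (at t within {0..1})" if "t \<in> {0..1}" for t
    using that by (simp only: telescope nilpotent scaleR_zero_right minus_zero)
  then obtain c where "\<And>t. t \<in> {0..1} \<Longrightarrow> h t = c"
    using has_vector_derivative_zero_constant[of "{0..1}" h] by auto
  then have "h 1 = h 0" by simp
  moreover have "h 1 = g 1"
  proof -
    have "h 1 = (\<Sum>n\<le>N. if n = 0 then g 1 else 0)"
      unfolding h_def by (intro sum.cong) (auto simp: power_0_left)
    then show ?thesis by simp
  qed
  ultimately show ?thesis by (simp add: h_def)
qed

section \<open>Polynomials in coordinate functions\<close>

lemma finite_multi_indices:
  assumes "finite I"
  shows "finite {m :: 'i \<Rightarrow> nat. (\<forall>i. i \<notin> I \<longrightarrow> m i = 0) \<and> (\<Sum>i\<in>I. m i) \<le> N}"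
proof (rule finite_subset)
  show "finite {m. \<forall>i. (i \<in> I \<longrightarrow> m i \<in> {..N}) \<and> (i \<notin> I \<longrightarrow> m i = 0)}"
    using assms by (intro finite_set_of_finite_funs) auto
  show "{m. (\<forall>i. i \<notin> I \<longrightarrow> m i = 0) \<and> (\<Sum>i\<in>I. m i) \<le> N}
      \<subseteq> {m. \<forall>i. (i \<in> I \<longrightarrow> m i \<in> {..N}) \<and> (i \<notin> I \<longrightarrow> m i = 0)}"
  proof clarsimp
    fix m :: "'i \<Rightarrow> nat" and i assume "(\<Sum>i\<in>I. m i) \<le> N" "i \<in> I"
    with member_le_sum[of i I m] assms show "m i \<le> N" by simp
  qed
qed

lemma polynomial_cong:
  assumes "polynomial_of_degree_le_on U N I y f" "\<And>x. x \<in> U \<Longrightarrow> f x = f' x"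
  shows "polynomial_of_degree_le_on U N I y f'"
  using assms unfolding polynomial_of_degree_le_on_def by auto

lemma polynomial_mono:
  assumes "polynomial_of_degree_le_on U N I y f" "N \<le> N'" "finite I"
  shows "polynomial_of_degree_le_on U N' I y f"
proof -
  obtain c where c: "\<And>x. x \<in> U \<Longrightarrow> f x =
        (\<Sum>m\<in>{m. (\<forall>i. i \<notin> I \<longrightarrow> m i = 0) \<and> (\<Sum>i\<in>I. m i) \<le> N}.
           c m * of_real (\<Prod>i\<in>I. y i x ^ m i))"
    using assms(1) unfolding polynomial_of_degree_le_on_def by blast
  show ?thesis
    unfolding polynomial_of_degree_le_on_def
  proof (intro exI[of _ "\<lambda>m. if (\<Sum>i\<in>I. m i) \<le> N then c m else 0"] ballI)
    fix x assume "x \<in> U"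
    then show "f x = (\<Sum>m\<in>{m. (\<forall>i. i \<notin> I \<longrightarrow> m i = 0) \<and> (\<Sum>i\<in>I. m i) \<le> N'}.
        (if (\<Sum>i\<in>I. m i) \<le> N then c m else 0) * of_real (\<Prod>i\<in>I. y i x ^ m i))"
      using assms(2) finite_multi_indices[OF assms(3), of N']
      by (subst c) (auto intro!: sum.mono_neutral_cong_left split: if_splits)
  qed
qed

lemma polynomial_const:
  assumes "finite I"
  shows "polynomial_of_degree_le_on U N I y (\<lambda>x. a)"
  unfolding polynomial_of_degree_le_on_def
proof (intro exI[of _ "\<lambda>m. if m = (\<lambda>_. 0) then a else 0"] ballI)
  fix x
  show "a = (\<Sum>m\<in>{m. (\<forall>i. i \<notin> I \<longrightarrow> m i = 0) \<and> (\<Sum>i\<in>I. m i) \<le> N}.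
      (if m = (\<lambda>_. 0) then a else 0) * of_real (\<Prod>i\<in>I. y i x ^ m i))"
    using finite_multi_indices[OF assms, of N]
    by (subst sum.mono_neutral_right[of _ "{\<lambda>_. 0}"]) auto
qed

lemma polynomial_add:
  assumes "polynomial_of_degree_le_on U N I y f" "polynomial_of_degree_le_on U N I y f'"
  shows "polynomial_of_degree_le_on U N I y (\<lambda>x. f x + f' x)"
proof -
  obtain c c' where "\<forall>x\<in>U. f x =
        (\<Sum>m\<in>{m. (\<forall>i. i \<notin> I \<longrightarrow> m i = 0) \<and> (\<Sum>i\<in>I. m i) \<le> N}.
           c m * of_real (\<Prod>i\<in>I. y i x ^ m i))"
    "\<forall>x\<in>U. f' x =
        (\<Sum>m\<in>{m. (\<forall>i. i \<notin> I \<longrightarrow> m i = 0) \<and> (\<Sum>i\<in>I. m i) \<le> N}.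
           c' m * of_real (\<Prod>i\<in>I. y i x ^ m i))"
    using assms unfolding polynomial_of_degree_le_on_def by blast
  then show ?thesis
    unfolding polynomial_of_degree_le_on_def
    by (intro exI[of _ "\<lambda>m. c m + c' m"]) (simp add: distrib_right sum.distrib)
qed

lemma polynomial_scaleR:
  assumes "polynomial_of_degree_le_on U N I y f"
  shows "polynomial_of_degree_le_on U N I y (\<lambda>x. r *\<^sub>R f x)"
proof -
  obtain c where "\<forall>x\<in>U. f x =
        (\<Sum>m\<in>{m. (\<forall>i. i \<notin> I \<longrightarrow> m i = 0) \<and> (\<Sum>i\<in>I. m i) \<le> N}.
           c m * of_real (\<Prod>i\<in>I. y i x ^ m i))"
    using assms unfolding polynomial_of_degree_le_on_def by blast
  then show ?thesis
    unfolding polynomial_of_degree_le_on_def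
    by (intro exI[of _ "\<lambda>m. r *\<^sub>R c m"]) (simp add: scaleR_sum_right)
qed

lemma polynomial_sum:
  assumes "finite I" "\<And>b. b \<in> S \<Longrightarrow> polynomial_of_degree_le_on U N I y (f b)"
  shows "polynomial_of_degree_le_on U N I y (\<lambda>x. \<Sum>b\<in>S. f b x)"
  using assms(2)
  by (induction S rule: infinite_finite_induct)
    (auto intro: polynomial_const[OF assms(1)] polynomial_add)

lemma polynomial_coordinate_mult:
  assumes "polynomial_of_degree_le_on U N I y f" and I: "finite I" and b: "b \<in> I"
  shows "polynomial_of_degree_le_on U (Suc N) I y (\<lambda>x. y b x *\<^sub>R f x)"
proof -
  let ?M = "\<lambda>N. {m. (\<forall>i. i \<notin> I \<longrightarrow> m i = 0) \<and> (\<Sum>i\<in>I. m i) \<le> N}"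
  obtain c where c: "\<And>x. x \<in> U \<Longrightarrow> f x =
        (\<Sum>m\<in>?M N. c m * of_real (\<Prod>i\<in>I. y i x ^ m i))"
    using assms(1) unfolding polynomial_of_degree_le_on_def by blast
  have order: "(\<Sum>i\<in>I. (m(b := n)) i) = n + (\<Sum>i\<in>I - {b}. m i)" for m and n :: nat
    using I b by (simp add: sum.remove[of I b])
  have order': "(\<Sum>i\<in>I. m i) = m b + (\<Sum>i\<in>I - {b}. m i)" for m :: "_ \<Rightarrow> nat"
    using I b by (simp add: sum.remove[of I b])
  have monomial: "(\<Prod>i\<in>I. y i x ^ (m(b := Suc (m b))) i) = y b x * (\<Prod>i\<in>I. y i x ^ m i)" for m x
    using I b by (simp add: prod.remove[of I b] mult.assoc)
  \<comment> \<open>multiplication by the coordinate shifts the exponent of \<open>b\<close>\<close>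
  show ?thesis
    unfolding polynomial_of_degree_le_on_def
  proof (intro exI[of _ "\<lambda>m. if m b = 0 then 0 else c (m(b := m b - 1))"] ballI)
    fix x assume "x \<in> U"
    then have "y b x *\<^sub>R f x = (\<Sum>m\<in>?M N. c m * of_real (\<Prod>i\<in>I. y i x ^ (m(b := Suc (m b))) i))"
      unfolding monomial by (simp add: c scaleR_conv_of_real sum_distrib_left mult_ac)
    also have "\<dots> = (\<Sum>m\<in>?M (Suc N). (if m b = 0 then 0 else c (m(b := m b - 1)))
        * of_real (\<Prod>i\<in>I. y i x ^ m i))"
    proof (rule sum.reindex_bij_witness_not_neutral[where S' = "{}"
          and T' = "{m \<in> ?M (Suc N). m b = 0}" and i = "\<lambda>m. m(b := m b - 1)"
          and j = "\<lambda>m. m(b := Suc (m b))"])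
      show "finite {m \<in> ?M (Suc N). m b = 0}" using finite_multi_indices[OF I, of "Suc N"] by (rule rev_finite_subset) auto
      show "m(b := m b - 1) \<in> ?M N - {}"
        if "m \<in> ?M (Suc N) - {m \<in> ?M (Suc N). m b = 0}" for m
        using that b order'[of m] by (auto simp: order simp del: fun_upd_apply sum.cong)
          (auto simp: fun_upd_apply)
      show "m(b := Suc (m b)) \<in> ?M (Suc N) - {m \<in> ?M (Suc N). m b = 0}"
        if "m \<in> ?M N - {}" for m
        using that b order'[of m] order[of m "Suc (m b)"] by auto
    qed auto
    finally show "y b x *\<^sub>R f x = (\<Sum>m\<in>?M (Suc N). (if m b = 0 then 0 else c (m(b := m b - 1)))
        * of_real (\<Prod>i\<in>I. y i x ^ m i))" .
  qed
qed

text \<open>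
  Each application of an operator depending linearly on \<open>\<xi>\<close> contributes one factor that is linear in
  the coordinates of \<open>\<xi>\<close>. The induction peels off the innermost application, which is why \<open>v\<close> has
  to vary.
\<close>

lemma polynomial_linear_power:
  fixes A :: "'g::real_vector \<Rightarrow> 'v::real_vector \<Rightarrow> 'v" and \<Lambda> :: "'v \<Rightarrow> 'l::real_normed_field"
  assumes I: "finite B" and \<xi>: "\<And>x. x \<in> U \<Longrightarrow> \<xi> x = (\<Sum>b\<in>B. y b x *\<^sub>R b)"
    and A: "\<And>v. linear (\<lambda>X. A X v)" "\<And>X. linear (A X)" and \<Lambda>: "linear \<Lambda>"
  shows "polynomial_of_degree_le_on U n B y (\<lambda>x. \<Lambda> ((A (\<xi> x) ^^ n) v))"
proof (induction n arbitrary: v)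
  case 0
  show ?case by (simp add: polynomial_const[OF I])
next
  case (Suc n)
  have "polynomial_of_degree_le_on U (Suc n) B y
      (\<lambda>x. \<Sum>b\<in>B. y b x *\<^sub>R \<Lambda> ((A (\<xi> x) ^^ n) (A b v)))"
    by (intro polynomial_sum I polynomial_coordinate_mult Suc.IH)
  then show ?case
  proof (rule polynomial_cong)
    fix x assume "x \<in> U"
    have "linear (\<lambda>v. \<Lambda> ((A (\<xi> x) ^^ n) v))"
      using linear_compose[OF linear_funpow[OF A(2)] \<Lambda>] by (simp add: comp_def)
    note lin = linear_sum[OF this] linear_scale[OF this]
    have "A (\<xi> x) v = (\<Sum>b\<in>B. y b x *\<^sub>R A b v)"
      using \<xi>[OF \<open>x \<in> U\<close>] by (simp add: linear_sum[OF A(1)] linear_scale[OF A(1)])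
    then have "(A (\<xi> x) ^^ Suc n) v = (A (\<xi> x) ^^ n) (\<Sum>b\<in>B. y b x *\<^sub>R A b v)"
      by (simp add: funpow_swap1)
    then show "(\<Sum>b\<in>B. y b x *\<^sub>R \<Lambda> ((A (\<xi> x) ^^ n) (A b v))) = \<Lambda> ((A (\<xi> x) ^^ Suc n) v)"
      by (simp only: lin)
  qed
qed


section \<open>Sections and frames of associated bundles\<close>

text \<open>
  In a local trivialisation the group acts on the second component by right multiplication.
\<close>

lemma principal_bundle_free:
  assumes "Group.group G" "carrier G = UNIV" "principal_bundle G AG P AQ AM prj act"
    "a \<in> P" "b \<in> P" "act u a = act u b"
  shows "a = b"
proof -
  interpret Group.group G by fact
  obtain U \<tau> where "prj u \<in> U"
    "\<forall>u\<in>prj -` U. fst (\<tau> u) = prj u \<and> (\<forall>a\<in>P. \<tau> (act u a) = (prj u, snd (\<tau> u) \<otimes>\<^bsub>G\<^esub> a))"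
    using assms(3) unfolding principal_bundle_def by meson
  then have "snd (\<tau> u) \<otimes>\<^bsub>G\<^esub> a = snd (\<tau> u) \<otimes>\<^bsub>G\<^esub> b"
    using assms(4-6) by (metis vimageI snd_conv)
  then show ?thesis using assms(2) by simp
qed

text \<open>
  This covers both the tractor bundle and its quotient \<open>H\<^sub>0M\<close>. On the latter only \<open>P\<close> acts, so the laws
  of a representation are asked for elements of \<open>P\<close> only. Freeness makes \<open>w\<close> the only second component
  over \<open>u\<close> in the class of \<open>(u, w)\<close>, which makes calculations with classes possible.
\<close>

locale free_action_with_rep = Group.group G
  for G :: "('a::{t2_space,second_countable_topology}, 'z) monoid_scheme" (structure)
    and P :: "'a set" and act :: "'q::{t2_space,second_countable_topology} \<Rightarrow> 'a \<Rightarrow> 'q"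
    and s :: "'l::real_normed_field \<Rightarrow> 'w::euclidean_space \<Rightarrow> 'w" and \<kappa> :: "'a \<Rightarrow> 'w \<Rightarrow> 'w" +
  assumes subgroup: "subgroup P G"
    and act_one: "act u \<one> = u"
    and act_mult: "a \<in> P \<Longrightarrow> b \<in> P \<Longrightarrow> act (act u a) b = act u (a \<otimes> b)"
    and act_free: "a \<in> P \<Longrightarrow> b \<in> P \<Longrightarrow> act u a = act u b \<Longrightarrow> a = b"
    and scalars: "scalar_mult s"
    and rep_one: "\<kappa> \<one> w = w"
    and rep_mult: "a \<in> P \<Longrightarrow> b \<in> P \<Longrightarrow> \<kappa> (a \<otimes> b) w = \<kappa> a (\<kappa> b w)"
    and rep_linear: "a \<in> P \<Longrightarrow> Vector_Spaces.linear s s (\<kappa> a)"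
begin

interpretation P: subgroup P G by (rule subgroup)

lemma mem_assoc_class: "(u, w') \<in> assoc_class G P act \<kappa> u w \<longleftrightarrow> w' = w"
proof
  assume "(u, w') \<in> assoc_class G P act \<kappa> u w"
  then obtain a where a: "a \<in> P" "act u a = u" "w' = \<kappa> (inv a) w"
    by (auto simp: assoc_class_def)
  then have "a = \<one>" using act_free[of a \<one> u] act_one by simp
  with a show "w' = w" by (simp add: rep_one)
next
  assume "w' = w"
  then show "(u, w') \<in> assoc_class G P act \<kappa> u w"
    unfolding assoc_class_def
    by (intro CollectI exI[of _ \<one>]) (simp add: act_one rep_one)
qed

lemma assoc_class_inject:
  "assoc_class G P act \<kappa> u w = assoc_class G P act \<kappa> u w' \<longleftrightarrow> w = w'"
  using mem_assoc_class by metis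

lemma assoc_class_translate:
  assumes a: "a \<in> P"
  shows "assoc_class G P act \<kappa> (act u a) (\<kappa> (inv a) w) = assoc_class G P act \<kappa> u w"
proof -
  have subset: "assoc_class G P act \<kappa> (act u a) (\<kappa> (inv a) w) \<subseteq> assoc_class G P act \<kappa> u w"
    if a: "a \<in> P" for u a w
  proof
    fix z assume "z \<in> assoc_class G P act \<kappa> (act u a) (\<kappa> (inv a) w)"
    then obtain b where b: "b \<in> P" "z = (act (act u a) b, \<kappa> (inv b) (\<kappa> (inv a) w))"
      by (auto simp: assoc_class_def)
    then have "z = (act u (a \<otimes> b), \<kappa> (inv (a \<otimes> b)) w)"
      using a by (simp add: act_mult inv_mult_group rep_mult)
    then show "z \<in> assoc_class G P act \<kappa> u w"
      using a b(1) by (auto simp: assoc_class_def)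
  qed
  have "act (act u a) (inv a) = u" "\<kappa> (inv (inv a)) (\<kappa> (inv a) w) = w"
    using a by (simp_all add: act_mult act_one rep_one flip: rep_mult)
  then show ?thesis
    using subset[OF a] subset[of "inv a" "act u a" "\<kappa> (inv a) w"] a by auto
qed

lemma section_fun_represents:
  assumes "\<alpha> (prj u) = assoc_class G P act \<kappa> u' w'" "a \<in> P" "u = act u' a"
  shows "\<alpha> (prj u) = assoc_class G P act \<kappa> u (section_fun G P prj act \<kappa> \<alpha> u)"
proof -
  have rep: "\<alpha> (prj u) = assoc_class G P act \<kappa> u (\<kappa> (inv a) w')"
    using assms(1,3) assoc_class_translate[OF assms(2), of u' w'] by simp
  then have "section_fun G P prj act \<kappa> \<alpha> u = \<kappa> (inv a) w'"
    unfolding section_fun_def rep assoc_class_inject by simp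
  with rep show ?thesis by simp
qed

text \<open>
  Representatives of different frame vectors with a common first component belong to the same
  element of \<open>P\<close> because the action is free; for the empty index set there would be no constraint
  on the first component at all.
\<close>

lemma fibre_lincomb_assoc_class:
  assumes "I \<noteq> {}"
  shows "fibre_lincomb s I c (\<lambda>i. assoc_class G P act \<kappa> u (e i))
       = assoc_class G P act \<kappa> u (\<Sum>i\<in>I. s (c i) (e i))"
proof -
  have lin: "\<kappa> (inv a) (\<Sum>i\<in>I. s (c i) (e i)) = (\<Sum>i\<in>I. s (c i) (\<kappa> (inv a) (e i)))" if "a \<in> P" for a
  proof -
    interpret Vector_Spaces.linear s s "\<kappa> (inv a)" using that by (intro rep_linear) simp
    show ?thesis by (simp add: sum scale)
  qed
  show ?thesis
  proof (rule subset_antisym; rule subsetI)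
    fix z assume "z \<in> fibre_lincomb s I c (\<lambda>i. assoc_class G P act \<kappa> u (e i))"
    then obtain u' w where z: "z = (u', \<Sum>i\<in>I. s (c i) (w i))"
      and w: "\<forall>i\<in>I. (u', w i) \<in> assoc_class G P act \<kappa> u (e i)"
      by (auto simp: fibre_lincomb_def)
    obtain i0 where "i0 \<in> I" using assms by blast
    with w obtain a where a: "a \<in> P" "u' = act u a"
      by (auto simp: assoc_class_def)
    have "w i = \<kappa> (inv a) (e i)" if "i \<in> I" for i
      using bspec[OF w that] a act_free by (auto simp: assoc_class_def)
    then have "z = (act u a, \<kappa> (inv a) (\<Sum>i\<in>I. s (c i) (e i)))"
      using z a lin by simp
    then show "z \<in> assoc_class G P act \<kappa> u (\<Sum>i\<in>I. s (c i) (e i))"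
      using a by (auto simp: assoc_class_def)
  next
    fix z assume "z \<in> assoc_class G P act \<kappa> u (\<Sum>i\<in>I. s (c i) (e i))"
    then obtain a where "a \<in> P" "z = (act u a, \<kappa> (inv a) (\<Sum>i\<in>I. s (c i) (e i)))"
      by (auto simp: assoc_class_def)
    then show "z \<in> fibre_lincomb s I c (\<lambda>i. assoc_class G P act \<kappa> u (e i))"
      unfolding fibre_lincomb_def
      by (intro CollectI exI[of _ "act u a"] exI[of _ "\<lambda>i. \<kappa> (inv a) (e i)"])
        (auto simp: lin assoc_class_def)
  qed
qed

lemma frame_coeff_normal_frame:
  assumes W: "\<not> module.dependent s W" "module.span s W = UNIV" and "w \<in> W"
    and \<alpha>: "\<alpha> x = assoc_class G P act \<kappa> (\<sigma> x) h"
  shows "frame_coeff s W (normal_frame G P act \<kappa> \<sigma>) \<alpha> w x = module.representation s W h w"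
proof -
  interpret vector_space s using scalars by (simp add: scalar_mult_def)
  \<comment> \<open>a real basis spans also over the larger field of scalars\<close>
  have "finite W"
  proof -
    have "UNIV \<subseteq> span Basis"
    proof
      fix v :: 'w
      have "(\<Sum>b\<in>Basis. s (of_real (v \<bullet> b)) b) \<in> span Basis"
        by (intro span_sum span_scale span_base)
      then show "v \<in> span Basis"
        using scalars by (simp add: scalar_mult_def euclidean_representation)
    qed
    then show ?thesis using independent_span_bound[of Basis W] W by auto
  qed
  have "frame_coeff s W (normal_frame G P act \<kappa> \<sigma>) \<alpha> w x
      = (THE c. (\<forall>j. j \<notin> W \<longrightarrow> c j = 0) \<and> h = (\<Sum>i\<in>W. s (c i) i)) w"
    unfolding frame_coeff_def normal_frame_def \<alpha>
    using \<open>w \<in> W\<close> by (subst fibre_lincomb_assoc_class) (auto simp: assoc_class_inject)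
  also have "(THE c. (\<forall>j. j \<notin> W \<longrightarrow> c j = 0) \<and> h = (\<Sum>i\<in>W. s (c i) i)) = representation W h"
  proof (rule the_equality)
    show "(\<forall>j. j \<notin> W \<longrightarrow> representation W h j = 0) \<and> h = (\<Sum>i\<in>W. s (representation W h i) i)"
      using W \<open>finite W\<close> representation_ne_zero sum_representation_eq[of W h W] by auto
    show "c = representation W h"
      if "(\<forall>j. j \<notin> W \<longrightarrow> c j = 0) \<and> h = (\<Sum>i\<in>W. s (c i) i)" for c
    proof -
      have "{b. c b \<noteq> 0} \<subseteq> W" using that by auto
      then show ?thesis
        using W that \<open>finite W\<close> by (intro representation_eqI[symmetric])
          (auto intro: finite_subset sum.mono_neutral_left)
    qed
  qed
  finally show ?thesis .
qed

end


text \<open>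
  The action on the quotient is given only through the values \<open>q v\<close>, so all laws are inherited from
  \<open>\<rho>\<close> by surjectivity of \<open>q\<close>.
\<close>

lemma quotient_rep_is_rep:
  assumes G: "Group.group G" "subgroup P G" and \<rho>: "representation_of G AG sv \<rho>"
    and q: "quotient_rep P sv \<rho> S sh \<rho>h q"
  shows "scalar_mult sh" "\<rho>h \<one>\<^bsub>G\<^esub> h = h"
    and "a \<in> P \<Longrightarrow> b \<in> P \<Longrightarrow> \<rho>h (a \<otimes>\<^bsub>G\<^esub> b) h = \<rho>h a (\<rho>h b h)"
    and "a \<in> P \<Longrightarrow> Vector_Spaces.linear sh sh (\<rho>h a)"
proof -
  interpret P: subgroup P G by fact
  note \<rho> = \<rho>[unfolded representation_of_def]
  show sh: "scalar_mult sh" using q by (simp add: quotient_rep_def)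
  have surj: "\<exists>v. h = q v" for h using q by (metis quotient_rep_def surjD)
  have induced: "\<rho>h a (q v) = q (\<rho> a v)" if "a \<in> P" for a v
    using q that by (simp add: quotient_rep_def)
  show "\<rho>h \<one>\<^bsub>G\<^esub> h = h" using surj[of h] induced \<rho> by auto
  show "\<rho>h (a \<otimes>\<^bsub>G\<^esub> b) h = \<rho>h a (\<rho>h b h)" if "a \<in> P" "b \<in> P"
    using surj[of h] induced \<rho> that by auto
  interpret q: Vector_Spaces.linear sv sh q using q by (simp add: quotient_rep_def)
  show "Vector_Spaces.linear sh sh (\<rho>h a)" if a: "a \<in> P"
  proof -
    interpret \<rho>a: Vector_Spaces.linear sv sv "\<rho> a" using \<rho> by simp
    have "\<rho>h a (h + h') = \<rho>h a h + \<rho>h a h'" for h h'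
      using surj[of h] surj[of h'] a by (auto simp: induced \<rho>a.add simp flip: q.add)
    moreover have "\<rho>h a (sh r h) = sh r (\<rho>h a h)" for r h
      using surj[of h] a by (auto simp: induced \<rho>a.scale simp flip: q.scale)
    ultimately show ?thesis
      using sh
      by (auto simp: scalar_mult_def Vector_Spaces.linear_def module_hom_def module_hom_axioms_def
          module_iff_vector_space)
  qed
qed

lemma bundle_projection_assoc_class:
  assumes "Group.group G" "subgroup P G" "quotient_rep P sv \<rho> S sh \<rho>h q"
  shows "bundle_projection q (assoc_class G P act \<rho> u v) = assoc_class G P act \<rho>h u (q v)"
proof -
  have "\<rho>h (inv\<^bsub>G\<^esub> a) (q v) = q (\<rho> (inv\<^bsub>G\<^esub> a) v)" if "a \<in> P" for a v
    using assms that subgroup.m_inv_closed[OF assms(2)] by (simp add: quotient_rep_def)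
  then show ?thesis
    unfolding bundle_projection_def assoc_class_def by force
qed


section \<open>Parallel sections along flows of constant fields\<close>

lemma parallel_section_class:
  assumes "parallel_section G L P AQ AM prj act \<omega> \<rho> s"
  shows "assoc_class G P act \<rho> u (dir_deriv (const_field AQ \<omega> X u) (section_fun G P prj act \<rho> s)
            + inf_action G L \<rho> X (section_fun G P prj act \<rho> s u)) = fibre_zero prj (prj u)"
  using assms unfolding parallel_section_def tractor_derivative_def by blast

context free_action_with_rep
begin

lemma parallel_section_derivative:
  assumes "parallel_section G L P AQ AM prj act \<omega> \<kappa> \<alpha>"
  defines "f \<equiv> section_fun G P prj act \<kappa> \<alpha>"
  shows "dir_deriv (const_field AQ \<omega> X u) f = - inf_action G L \<kappa> X (f u)"
proof -
  let ?w = "dir_deriv (const_field AQ \<omega> X u) f + inf_action G L \<kappa> X (f u)"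
  have "(u, ?w) \<in> fibre_zero prj (prj u)"
    using mem_assoc_class[of u ?w ?w] parallel_section_class[OF assms(1)] unfolding f_def by metis
  then show ?thesis by (simp add: fibre_zero_def add_eq_0_iff)
qed

text \<open>
  The zero element of the fibre over \<open>x\<close> consists of all pairs \<open>(u, 0)\<close> with \<open>u\<close> over \<open>x\<close>. That the
  covariant derivative equals it therefore says in particular that \<open>P\<close> acts transitively on fibres.
\<close>

lemma parallel_section_transitive:
  assumes "parallel_section G L P AQ AM prj act \<omega> \<kappa> \<alpha>" "prj u' = prj u"
  shows "\<exists>a\<in>P. u' = act u a"
proof -
  have "(u', 0 :: 'w) \<in> fibre_zero prj (prj u)" using assms(2) by (simp add: fibre_zero_def)
  then show ?thesis
    unfolding parallel_section_class[OF assms(1), where u = u and X = 0, symmetric]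
    by (auto simp: assoc_class_def)
qed

text \<open>
  A section only promises some representative over each point; transitivity moves it to the given
  point \<open>u\<close> of the fibre.
\<close>

lemma parallel_section_value:
  assumes "parallel_section G L P AQ AM prj act \<omega> \<kappa> \<alpha>"
  shows "\<alpha> (prj u) = assoc_class G P act \<kappa> u (section_fun G P prj act \<kappa> \<alpha> u)"
proof -
  obtain u' w' where "prj u' = prj u" "\<alpha> (prj u) = assoc_class G P act \<kappa> u' w'"
    using assms unfolding parallel_section_def smooth_section_def by blast
  then show ?thesis
    using parallel_section_transitive[OF assms, of u u'] section_fun_represents by metis
qed

text \<open>
  On an integral curve of the field with \<open>\<omega> = X\<close>, parallelism is the linear differential equation
  \<open>f' = - X \<cdot> f\<close> with constant coefficients; its solution is \<open>exp (-X) (f u0)\<close>.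
\<close>

lemma parallel_section_along_flow:
  assumes par: "parallel_section G L P AQ AM prj act \<omega> \<kappa> \<alpha>"
    and lin: "linear (inf_action G L \<kappa> X)"
    and nilpotent: "\<And>v. (inf_action G L \<kappa> X ^^ Suc N) v = 0"
    and flow: "flows_to AQ (const_field AQ \<omega> X) 1 u0 u1"
  defines "f \<equiv> section_fun G P prj act \<kappa> \<alpha>"
  shows "f u1 = (\<Sum>n\<le>N. ((-1) ^ n / fact n) *\<^sub>R (inf_action G L \<kappa> X ^^ n) (f u0))"
proof -
  obtain J c where J: "0 \<in> J" "1 \<in> J" "connected J" and c: "c 0 = u0" "c 1 = u1"
    and integral: "\<And>t h. t \<in> J \<Longrightarrow> smooth_fun AQ h \<Longrightarrow>
        ((h \<circ> c) has_real_derivative const_field AQ \<omega> X (c t) h) (at t)"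
    using flow unfolding flows_to_def integral_curve_def by blast
  have smooth: "smooth_fun AQ f"
    using par by (simp add: f_def parallel_section_def smooth_section_def)
  have "((\<lambda>t. f (c t)) has_vector_derivative - inf_action G L \<kappa> X (f (c t))) (at t)"
    if "t \<in> {0..1}" for t
  proof -
    have "t \<in> J" using connected_contains_Icc[OF J(3,1,2)] that by blast
    then have "((\<lambda>t. f (c t) \<bullet> b) has_real_derivative
        const_field AQ \<omega> X (c t) (\<lambda>u. f u \<bullet> b)) (at t)" for b
      using integral[OF _ smooth_fun_inner[OF smooth]] by (simp add: comp_def)
    then have "((\<lambda>t. \<Sum>b\<in>Basis. (f (c t) \<bullet> b) *\<^sub>R b) has_vector_derivative
        (\<Sum>b\<in>Basis. const_field AQ \<omega> X (c t) (\<lambda>u. f u \<bullet> b) *\<^sub>R b)) (at t)"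
      by (intro has_vector_derivative_sum
          bounded_linear.has_vector_derivative[OF bounded_linear_scaleR_left])
        (simp only: has_real_derivative_iff_has_vector_derivative)
    then show ?thesis
      using parallel_section_derivative[OF par, folded f_def, of X "c t"]
      by (simp add: euclidean_representation dir_deriv_def)
  qed
  then show ?thesis
    using nilpotent_linear_ode[of "\<lambda>t. f (c t)", OF _ lin nilpotent] c by simp
qed

end


section \<open>Normal solutions in normal frames\<close>

theorem theorem2p10:
  fixes sg :: "'k::real_normed_field \<Rightarrow> 'g::euclidean_space \<Rightarrow> 'g"
    and br :: "'g \<Rightarrow> 'g \<Rightarrow> 'g"
    and k N :: nat
    and gr :: "int \<Rightarrow> 'g set"
    and G :: "('a::{t2_space,second_countable_topology}, 'z) monoid_scheme"
    and AG :: "('a, 'e::euclidean_space) chart set"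
    and L :: "'g \<Rightarrow> 'a \<Rightarrow> 'a tvec"
    and P :: "'a set"
    and AQ :: "('q::{t2_space,second_countable_topology}, 'eq::euclidean_space) chart set"
    and AM :: "('m::{t2_space,second_countable_topology}, 'em::euclidean_space) chart set"
    and prj :: "'q \<Rightarrow> 'm"
    and act :: "'q \<Rightarrow> 'a \<Rightarrow> 'q"
    and \<omega> :: "'q \<Rightarrow> 'q tvec \<Rightarrow> 'g"
    and sv :: "'l::real_normed_field \<Rightarrow> 'v::euclidean_space \<Rightarrow> 'v"
    and \<rho> :: "'a \<Rightarrow> 'v \<Rightarrow> 'v"
    and E :: 'g
    and Vg :: "nat \<Rightarrow> 'v set"
    and sh :: "'l \<Rightarrow> 'h::euclidean_space \<Rightarrow> 'h"
    and \<rho>h :: "'a \<Rightarrow> 'h \<Rightarrow> 'h"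
    and q :: "'v \<Rightarrow> 'h"
    and \<alpha> :: "'m \<Rightarrow> ('q \<times> 'h) set"
    and u0 :: 'q
    and V B :: "'g set"
    and W :: "'h set"
  assumes type: "parabolic_type sg br k gr G AG L P"
    and geometry: "parabolic_geometry k gr G AG L P AQ AM prj act \<omega>"
    and rep: "irreducible_rep G AG sv \<rho>"
    and grading_element: "grading_element br gr E"
    and grading: "natural_grading sv (inf_action G L \<rho> E) N Vg"
    and H0: "quotient_rep P sv \<rho> (graded_part Vg {1..N}) sh \<rho>h q"
    and solution: "normal_solution G L P AQ AM prj act \<omega> \<rho> \<rho>h q \<alpha>"
    and V: "normal_domain AQ AM prj \<omega> u0 (g_minus k gr) V"
    and B: "independent B" "span B = g_minus k gr"
    and W: "\<not> module.dependent sh W" "module.span sh W = UNIV"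
    and w: "w \<in> W"
  shows "polynomial_of_degree_le_on (normal_param AQ prj \<omega> u0 ` V) N
           B (normal_coord AQ prj \<omega> u0 V B)
           (frame_coeff sh W (normal_frame G P act \<rho>h (normal_section AQ prj \<omega> u0 V)) \<alpha> w)"
proof -
  have lie_group: "lie_group G AG" "lie_algebra_of G AG br L" and P: "subgroup P G"
    using assms(1) by (simp_all add: parabolic_type_def)
  then have group: "Group.group G" "carrier G = UNIV" by (simp_all add: lie_group_def)
  have \<rho>: "representation_of G AG sv \<rho>" using rep by (simp add: irreducible_rep_def)
  have principal: "principal_bundle G AG P AQ AM prj act"
    using geometry by (simp add: parabolic_geometry_def)
  note quotient = quotient_rep_is_rep[OF group(1) P \<rho> H0]
  interpret R: lie_group_representation G AG br L sv \<rho>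
    by unfold_locales (use lie_group \<rho> in auto)
  have act: "act u \<one>\<^bsub>G\<^esub> = u"
    "a \<in> P \<Longrightarrow> b \<in> P \<Longrightarrow> act (act u a) b = act u (a \<otimes>\<^bsub>G\<^esub> b)"
    "a \<in> P \<Longrightarrow> b \<in> P \<Longrightarrow> act u a = act u b \<Longrightarrow> a = b" for u a b
    using principal principal_bundle_free[OF group principal] by (auto simp: principal_bundle_def)
  interpret tractor: free_action_with_rep G P act sv \<rho>
    using group(1) P act R.scalars \<rho>
    unfolding free_action_with_rep_def free_action_with_rep_axioms_def
    by (simp add: representation_of_def)
  interpret quot: free_action_with_rep G P act sh \<rho>h
    using group(1) P act quotient
    unfolding free_action_with_rep_def free_action_with_rep_axioms_def by simp

  obtain s where par: "parallel_section G L P AQ AM prj act \<omega> \<rho> s"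
    and \<alpha>: "\<And>x. \<alpha> x = bundle_projection q (s x)"
    using solution unfolding normal_solution_def by blast
  \<comment> \<open>\<open>\<Lambda>\<close> is the coefficient at \<open>w\<close> of the projection to the quotient, as a real-linear function\<close>
  define f where "f = section_fun G P prj act \<rho> s"
  define \<Lambda> where "\<Lambda> = (\<lambda>v. module.representation sh W (q v) w)"
  define \<xi> where "\<xi> = normal_chart AQ prj \<omega> u0 V"
  define U where "U = normal_param AQ prj \<omega> u0 ` V"

  have \<Lambda>: "linear \<Lambda>"
  proof -
    interpret h: vector_space sh using quotient(1) by (simp add: scalar_mult_def)
    have "linear q"
      using H0 scalar_linear_imp_linear[OF R.scalars quotient(1)] by (simp add: quotient_rep_def)
    moreover have "linear (\<lambda>v. h.representation W v w)"
    proof (rule linearI)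
      show "h.representation W (v + v') w = h.representation W v w + h.representation W v' w" for v v'
        using W by (simp add: h.representation_add)
      show "h.representation W (r *\<^sub>R v) w = r *\<^sub>R h.representation W v w" for r v
      proof -
        have "r *\<^sub>R v = sh (of_real r) v" using quotient(1) by (simp add: scalar_mult_def)
        then have "h.representation W (r *\<^sub>R v) w = of_real r * h.representation W v w"
          using h.representation_scale[OF W(1), of v] W(2) by simp
        then show ?thesis by (simp only: scaleR_conv_of_real)
      qed
    qed
    ultimately show ?thesis
      unfolding \<Lambda>_def using linear_compose[of q "\<lambda>v. h.representation W v w"] by (simp only: comp_def)
  qed

  \<comment> \<open>in the frame over the normal section, the coefficient is read off from the values of \<open>f\<close> there\<close>
  have coeff: "frame_coeff sh W (normal_frame G P act \<rho>h (normal_section AQ prj \<omega> u0 V)) \<alpha> w x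
      = (\<Sum>n\<le>N. ((-1) ^ n / fact n) *\<^sub>R \<Lambda> ((R.dact (\<xi> x) ^^ n) (f u0)))"
    and coords: "\<xi> x = (\<Sum>b\<in>B. normal_coord AQ prj \<omega> u0 V B b x *\<^sub>R b)"
    if x: "x \<in> U" for x
  proof -
    let ?\<sigma> = "normal_section AQ prj \<omega> u0 V"
    have \<xi>: "\<xi> x \<in> V" "normal_param AQ prj \<omega> u0 (\<xi> x) = x"
      using x by (simp_all add: \<xi>_def U_def normal_chart_def inv_into_into f_inv_into_f)
    then have prj: "prj (?\<sigma> x) = x"
      by (simp add: normal_section_def normal_param_def \<xi>_def)
    have g_minus: "\<xi> x \<in> g_minus k gr"
      using V \<xi>(1) openin_subset[of "top_of_set (g_minus k gr)" V] by (auto simp: normal_domain_def)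
    have "flows_to AQ (const_field AQ \<omega> (\<xi> x)) 1 u0 (?\<sigma> x)"
      using V \<xi>(1) someI_ex[of "flows_to AQ (const_field AQ \<omega> (\<xi> x)) 1 u0"]
      by (simp add: normal_domain_def normal_section_def normal_lift_def flow_def \<xi>_def)
    then have "f (?\<sigma> x) = (\<Sum>n\<le>N. ((-1) ^ n / fact n) *\<^sub>R (R.dact (\<xi> x) ^^ n) (f u0))"
      unfolding f_def
      by (intro tractor.parallel_section_along_flow[OF par R.dact_linear]
          R.g_minus_nilpotent[OF grading_element grading g_minus])
    then have "\<Lambda> (f (?\<sigma> x)) = (\<Sum>n\<le>N. ((-1) ^ n / fact n) *\<^sub>R \<Lambda> ((R.dact (\<xi> x) ^^ n) (f u0)))"
      by (simp only: linear_sum[OF \<Lambda>] linear_scale[OF \<Lambda>])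
    moreover have "\<alpha> x = assoc_class G P act \<rho>h (?\<sigma> x) (q (f (?\<sigma> x)))"
      using tractor.parallel_section_value[OF par, of "?\<sigma> x"]
      by (simp add: \<alpha> prj f_def bundle_projection_assoc_class[OF group(1) P H0])
    ultimately show "frame_coeff sh W (normal_frame G P act \<rho>h ?\<sigma>) \<alpha> w x
        = (\<Sum>n\<le>N. ((-1) ^ n / fact n) *\<^sub>R \<Lambda> ((R.dact (\<xi> x) ^^ n) (f u0)))"
      using quot.frame_coeff_normal_frame[where \<alpha> = \<alpha> and \<sigma> = ?\<sigma> and x = x, OF W w] by (simp add: \<Lambda>_def)
    show "\<xi> x = (\<Sum>b\<in>B. normal_coord AQ prj \<omega> u0 V B b x *\<^sub>R b)"
      using real_vector.sum_representation_eq[of B "\<xi> x" B] B g_minus independent_imp_finite[OF B(1)]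
      by (simp add: normal_coord_def \<xi>_def)
  qed
  have "finite B" using B(1) by (rule independent_imp_finite)
  then have "polynomial_of_degree_le_on U N B (normal_coord AQ prj \<omega> u0 V B)
      (\<lambda>x. \<Sum>n\<le>N. ((-1) ^ n / fact n) *\<^sub>R \<Lambda> ((R.dact (\<xi> x) ^^ n) (f u0)))"
    using coords
    by (intro polynomial_sum polynomial_scaleR polynomial_mono[OF polynomial_linear_power]
        R.dact_linear R.dact_linear_left \<Lambda>) auto
  then show ?thesis
    unfolding U_def[symmetric] by (rule polynomial_cong) (simp add: coeff)
qed

end
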